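(* Let $k\ge 0$ and $\Delta t>0$. If $\mathbf U_h\in\mathbb G_h^k$ (with $\mathbb S_K=\widehat{\mathbb S}_K\cup\breve{\mathbb S}_K$), then $$\mathbf U_h+\Delta t\,\mathbf L_h(\mathbf U_h)\in\overline{\mathbb G}_h^k$$ provided the following CFL type condition holds: $$\Delta t\,\frac{|\mathscr E|}{|K|}\big(a+\sigma_{K,\mathscr E,q}(\mathbf U_h)\big)<\frac{\varpi_{\mathscr E}^{(q)}}{\omega_q},\qquad 1\le q\le Q,\ \forall\mathscr E\in\partial K,\ \forall K\in\mathcal T_h,$$ where $a=1$ and $$\sigma_{K,\mathscr E,q}(\mathbf U_h):=\frac12\,\frac{\big|\big\langle\mathbf n_{\mathscr E,K},\ \mathbf B_{\mathscr E,q}^{\mathrm{int}(K)}-\mathbf B_{\mathscr E,q}^{\mathrm{ext}(K)}\big\rangle\big|}{\sqrt{\rho_{\mathscr E,q}^{\mathrm{int}(K)}H_{\mathscr E,q}^{\mathrm{int}(K)}}},$$ with $\mathbf U_{\mathscr E,q}^{\mathrm{int}(K)}:=\mathbf U_h^{\mathrm{int}(K)}(\mathbf x_{\mathscr E}^{(q)})$, $\mathbf U_{\mathscr E,q}^{\mathrm{ext}(K)}:=\mathbf U_h^{\mathrm{ext}(K)}(\mathbf x_{\mathscr E}^{(q)})$, and $\rho,H,\mathbf B$ with the same sub/superscripts the corresponding density, specific enthalpy and magnetic field.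
   Context: **RMHD quantities.** The equation of state is a function $H=H(p,\rho)$, differentiable on $(0,\infty)^2$, satisfying for all $p,\rho>0$: $H(p,\rho)\ge\sqrt{1+p^2/\rho^2}+p/\rho$ and $H(p,\rho)\big(\frac1\rho-\frac{\partial H}{\partial p}\big)<\frac{\partial H}{\partial\rho}<0$. For $\rho,p>0$, $\mathbf v,\mathbf B\in\mathbb R^3$, $|\mathbf v|<1$, put $W=(1-|\mathbf v|^2)^{-1/2}$, $H=H(p,\rho)$, $e=H-1-p/\rho$, $p_{tot}=p+\frac12(W^{-2}|\mathbf B|^2+(\mathbf v\cdot\mathbf B)^2)$, $D=\rho W$, $\mathbf m=(\rho HW^2+|\mathbf B|^2)\mathbf v-(\mathbf v\cdot\mathbf B)\mathbf B$, $E=\rho HW^2-p_{tot}+|\mathbf B|^2$. The admissible set $\mathcal G\subset\mathbb R^8$ is the set of $\mathbf U=(D,\mathbf m,\mathbf B,E)^\top$ arising from such primitive variables with $\rho>0$, $p>0$, $e>0$, $|\mathbf v|<1$; each $\mathbf U\in\mathcal G$ determines its primitive variables uniquely, so $\rho,p,\mathbf v,H$ are functions of $\mathbf U\in\mathcal G$. For $\mathbf U\in\mathcal G$, $\mathbf F_i(\mathbf U)=\big(Dv_i,\ v_i\mathbf m-B_i(W^{-2}\mathbf B+(\mathbf v\cdot\mathbf B)\mathbf v)+p_{tot}\mathbf e_i,\ v_i\mathbf B-B_i\mathbf v,\ m_i\big)^\top$ ($\mathbf e_i$ the $i$-th row of the $3\times 3$ identity), and $\mathbf S(\mathbf U)=\big(0,(1-|\mathbf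 v|^2)\mathbf B+(\mathbf v\cdot\mathbf B)\mathbf v,\mathbf v,\mathbf v\cdot\mathbf B\big)^\top$. Here $d=2$; for $\mathbf n\in\mathbb R^d$, $\langle\mathbf n,\mathbf B\rangle=\sum_{j=1}^dn_jB_j$ and $\langle\mathbf n,\mathbf F\rangle=\sum_{j=1}^dn_j\mathbf F_j$. **Mesh and spaces.** A bounded 2D domain is partitioned into a mesh $\mathcal T_h$ of polygonal cells $K$ of area $|K|$; $\mathscr E\in\partial K$ denotes an edge of $K$, of length $|\mathscr E|$, with outward unit normal $\mathbf n_{\mathscr E,K}$. Every edge of $K$ is shared with exactly one adjacent cell (e.g. periodic boundary conditions); for a piecewise polynomial $\mathbf U_h$, superscripts $\mathrm{int}(K)$ and $\mathrm{ext}(K)$ denote the traces on $\mathscr E$ from inside $K$ and from the adjacent cell. $\mathbb W_h^k$ is the space of $\mathbf u=(u_1,\dots,u_8)^\top$ with each $u_\ell|_K$ a polynomial of total degree $\le k$ and $\sum_{i=1}^d\partial u_{4+i}/\partial x_i=0$ in each $K\in\mathcal T_h$ (components $5,6,7$ are the magnetic field). Given point sets $\mathbb S_K\subset K$, $\overline{\mathbb G}_h^k=\{\mathbf u\in\mathbb W_h^k:\frac1{|K|}\int_K\mathbf u\,d\mathbf x\in\mathcal G\ \forall K\in\mathcal T_h\}$ and $\mathbb G_h^k=\{\mathbf u\in\overline{\mathbb G}_h^k:\mathbf u|_K(\mathbf x)\in\mathcal G\ \forall\mathbf x\in\mathbb S_K,\ \forall K\in\mathcal T_h\}$. **Quadratures.**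 On each edge $\mathscr E$: the Gauss quadrature with $Q=k+1$ points $\mathbf x_{\mathscr E}^{(q)}$ and positive weights $\omega_q$, $\sum_q\omega_q=1$. On each cell $K$: a quadrature with points $\breve{\mathbf x}_K^{(q)}$ and weights $\breve\omega_q$, $1\le q\le\breve Q$, of algebraic degree at least $2k$; $\breve{\mathbb S}_K=\{\breve{\mathbf x}_K^{(q)}\}$. It is also assumed that each $K$ admits a special quadrature with positive weights, summing to $1$, whose nodes include all edge Gauss points: $$\frac1{|K|}\int_Ku\,d\mathbf x=\sum_{\mathscr E\in\partial K}\sum_{q=1}^Q\varpi_{\mathscr E}^{(q)}u(\mathbf x_{\mathscr E}^{(q)})+\sum_{q=1}^{\widetilde Q}\widetilde\varpi_q\,u(\widetilde{\mathbf x}_K^{(q)})$$ for all polynomials $u$ of degree $\le k$ on $K$; $\widehat{\mathbb S}_K$ is the set of all its nodes ($\mathbf x_{\mathscr E}^{(q)}$ and $\widetilde{\mathbf x}_K^{(q)}\in K$). Set $\mathbb S_K=\widehat{\mathbb S}_K\cup\breve{\mathbb S}_K$. **The operator $\mathbf L_h$.** The numerical flux is $\hat{\mathbf F}(\mathbf U^-,\mathbf U^+;\mathbf n)=\frac12\big(\langle\mathbf n,\mathbf F(\mathbf U^-)+\mathbf F(\mathbf U^+)\rangle-a(\mathbf U^+-\mathbf U^-)\big)$ with $a=1$. For $\mathbf U_h\in\mathbb G_h^k$, $\mathbf L_h(\mathbf U_h)\in\mathbb W_h^k$ is defined by $\int_K\mathbf L_h(\mathbf U_h)\cdot\mathbf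 u\,d\mathbf x=\mathcal J_K(\mathbf U_h,\mathbf u)$ for all $\mathbf u\in\mathbb W_h^k$, $K\in\mathcal T_h$, where $$\mathcal J_K(\mathbf U_h,\mathbf u)=-\sum_{\mathscr E\in\partial K}|\mathscr E|\sum_{q=1}^Q\omega_q\Big[\hat{\mathbf F}\big(\mathbf U_h^{\mathrm{int}(K)},\mathbf U_h^{\mathrm{ext}(K)};\mathbf n_{\mathscr E,K}\big)+\tfrac12\big\langle\mathbf n_{\mathscr E,K},\mathbf B_h^{\mathrm{ext}(K)}-\mathbf B_h^{\mathrm{int}(K)}\big\rangle\mathbf S\big(\mathbf U_h^{\mathrm{int}(K)}\big)\Big]\cdot\mathbf u^{\mathrm{int}(K)}\Big|_{\mathbf x_{\mathscr E}^{(q)}}+|K|\sum_{q=1}^{\breve Q}\breve\omega_q\sum_{i=1}^d\mathbf F_i\big(\mathbf U_h(\breve{\mathbf x}_K^{(q)})\big)\cdot\frac{\partial\mathbf u}{\partial x_i}(\breve{\mathbf x}_K^{(q)}).$$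
   Formalization: The formal theorem additionally assumes that e(p,ρ)=H−1−p/ρ tends to 0 as p→0+ for every ρ>0; without it the claim fails, e.g. for H=1+2p/ρ+1/(1+ρ) with k=0 on a periodic checkerboard with D=1, D=3, p=0.01, v=B=0. *)

theory Defs
  imports "HOL-Analysis.Analysis" "HOL-Computational_Algebra.Polynomial"
begin

section \<open>Relativistic magnetohydrodynamics\<close>

(* R^8 with its Euclidean structure, in the block form (D, m, B, E). *)
type_synonym state = "real \<times> (real^3) \<times> (real^3) \<times> real"

(* (rho, v, B, p) *)
type_synonym prim = "real \<times> (real^3) \<times> (real^3) \<times> real"

(* The equation of state is H p rho: pressure first, density second. *)
definition eos :: "(real \<Rightarrow> real \<Rightarrow> real) \<Rightarrow> bool" where
  "eos H \<longleftrightarrow> (\<forall>p>0. \<forall>\<rho>>0.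
     (\<lambda>(p, \<rho>). H p \<rho>) differentiable (at (p, \<rho>)) \<and>
     H p \<rho> \<ge> sqrt (1 + p^2 / \<rho>^2) + p / \<rho> \<and>
     H p \<rho> * (1 / \<rho> - deriv (\<lambda>p'. H p' \<rho>) p) < deriv (\<lambda>\<rho>'. H p \<rho>') \<rho> \<and>
     deriv (\<lambda>\<rho>'. H p \<rho>') \<rho> < 0)"

definition internal_energy :: "(real \<Rightarrow> real \<Rightarrow> real) \<Rightarrow> real \<Rightarrow> real \<Rightarrow> real" where
  "internal_energy H p \<rho> = H p \<rho> - 1 - p / \<rho>"

definition lorentz :: "real^3 \<Rightarrow> real" where
  "lorentz v = 1 / sqrt (1 - (norm v)^2)"

definition p_tot :: "prim \<Rightarrow> real" where
  "p_tot = (\<lambda>(\<rho>, v, B, p). p + ((norm B)^2 / (lorentz v)^2 + (v \<bullet> B)^2) / 2)"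

definition conserved :: "(real \<Rightarrow> real \<Rightarrow> real) \<Rightarrow> prim \<Rightarrow> state" where
  "conserved H = (\<lambda>(\<rho>, v, B, p). let W = lorentz v in
     (\<rho> * W,
      (\<rho> * H p \<rho> * W^2 + (norm B)^2) *\<^sub>R v - (v \<bullet> B) *\<^sub>R B,
      B,
      \<rho> * H p \<rho> * W^2 - p_tot (\<rho>, v, B, p) + (norm B)^2))"

definition admissible_prim :: "(real \<Rightarrow> real \<Rightarrow> real) \<Rightarrow> prim set" where
  "admissible_prim H = {(\<rho>, v, B, p). \<rho> > 0 \<and> p > 0 \<and> internal_energy H p \<rho> > 0 \<and> norm v < 1}"

definition admissible :: "(real \<Rightarrow> real \<Rightarrow> real) \<Rightarrow> state set" where
  "admissible H = conserved H ` admissible_prim H"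

(* Recovery of the primitive variables; meaningful only on admissible H. *)
definition prim_of :: "(real \<Rightarrow> real \<Rightarrow> real) \<Rightarrow> state \<Rightarrow> prim" where
  "prim_of H = inv_into (admissible_prim H) (conserved H)"

definition mag :: "state \<Rightarrow> real^3" where
  "mag = (\<lambda>(D, m, B, E). B)"

definition density :: "(real \<Rightarrow> real \<Rightarrow> real) \<Rightarrow> state \<Rightarrow> real" where
  "density H U = (case prim_of H U of (\<rho>, v, B, p) \<Rightarrow> \<rho>)"

definition enthalpy :: "(real \<Rightarrow> real \<Rightarrow> real) \<Rightarrow> state \<Rightarrow> real" where
  "enthalpy H U = (case prim_of H U of (\<rho>, v, B, p) \<Rightarrow> H p \<rho>)"

definition velocity :: "(real \<Rightarrow> real \<Rightarrow> real) \<Rightarrow> state \<Rightarrow> real^3" where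
  "velocity H U = (case prim_of H U of (\<rho>, v, B, p) \<Rightarrow> v)"

definition flux :: "(real \<Rightarrow> real \<Rightarrow> real) \<Rightarrow> 3 \<Rightarrow> state \<Rightarrow> state" where
  "flux H i U = (case U of (D, m, B, E) \<Rightarrow> let v = velocity H U; W = lorentz v in
     (D * v $ i,
      v $ i *\<^sub>R m - B $ i *\<^sub>R ((1 / W^2) *\<^sub>R B + (v \<bullet> B) *\<^sub>R v) + p_tot (prim_of H U) *\<^sub>R axis i 1,
      v $ i *\<^sub>R B - B $ i *\<^sub>R v,
      m $ i))"

definition source :: "(real \<Rightarrow> real \<Rightarrow> real) \<Rightarrow> state \<Rightarrow> state" where
  "source H U = (let v = velocity H U; B = mag U in
     (0, (1 - (norm v)^2) *\<^sub>R B + (v \<bullet> B) *\<^sub>R v, v, v \<bullet> B))"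

definition ndotB :: "real^2 \<Rightarrow> real^3 \<Rightarrow> real" where
  "ndotB n B = n $ 1 * B $ 1 + n $ 2 * B $ 2"

definition ndotF :: "(real \<Rightarrow> real \<Rightarrow> real) \<Rightarrow> real^2 \<Rightarrow> state \<Rightarrow> state" where
  "ndotF H n U = n $ 1 *\<^sub>R flux H 1 U + n $ 2 *\<^sub>R flux H 2 U"

(* The viscosity parameter a of the numerical flux, equal to the speed of light. *)
definition a_visc :: real where
  "a_visc = 1"

definition num_flux :: "(real \<Rightarrow> real \<Rightarrow> real) \<Rightarrow> state \<Rightarrow> state \<Rightarrow> real^2 \<Rightarrow> state" where
  "num_flux H Um Up n = (1/2) *\<^sub>R (ndotF H n Um + ndotF H n Up - a_visc *\<^sub>R (Up - Um))"


section \<open>Polygonal meshes\<close>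

type_synonym cell = "(real^2) set"

(* An edge of a cell K is the pair (a, b) of its endpoints, ordered such that K lies
   to the left when walking from a to b. *)
type_synonym edge = "(real^2) \<times> (real^2)"

definition edge_length :: "edge \<Rightarrow> real" where
  "edge_length = (\<lambda>(a, b). dist a b)"

(* The direction b - a rotated clockwise by a right angle. *)
definition edge_normal :: "edge \<Rightarrow> real^2" where
  "edge_normal = (\<lambda>(a, b). (1 / dist a b) *\<^sub>R vector [(b - a) $ 2, - ((b - a) $ 1)])"

(* Cells need be neither convex nor simply connected, and consecutive edges may be collinear
   (hanging nodes).  The last conjunct says that edge_normal is the outward normal. *)
definition polygonal_cell :: "cell \<Rightarrow> edge set \<Rightarrow> bool" where
  "polygonal_cell K es \<longleftrightarrow>
     compact K \<and> interior K \<noteq> {} \<and> connected (interior K) \<and> closure (interior K) = K \<and>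
     finite es \<and> (\<forall>(a, b) \<in> es. a \<noteq> b) \<and>
     frontier K = (\<Union>(a, b) \<in> es. closed_segment a b) \<and>
     (\<forall>(a, b) \<in> es. \<forall>(a', b') \<in> es. (a, b) \<noteq> (a', b') \<longrightarrow>
        open_segment a b \<inter> closed_segment a' b' = {}) \<and>
     (\<forall>(a, b) \<in> es. \<forall>x \<in> open_segment a b. \<exists>\<delta>>0. \<forall>t. 0 < t \<and> t < \<delta> \<longrightarrow>
        x + t *\<^sub>R edge_normal (a, b) \<notin> K \<and> x - t *\<^sub>R edge_normal (a, b) \<in> K)"

(* neighbor M K e is the cell adjacent to K across its edge e.  A point x of e corresponds to the
   point x + shift M K e of the neighbour; the shift is nonzero only for boundary edges that
   are identified by periodicity. *)
record mesh =
  region :: "(real^2) set"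
  cells :: "cell set"
  edges :: "cell \<Rightarrow> edge set"
  neighbor :: "cell \<Rightarrow> edge \<Rightarrow> cell"
  shift :: "cell \<Rightarrow> edge \<Rightarrow> real^2"

(* From the neighbour, an edge is traversed in the opposite direction. *)
definition opposite_edge :: "mesh \<Rightarrow> cell \<Rightarrow> edge \<Rightarrow> edge" where
  "opposite_edge M K e = (snd e + shift M K e, fst e + shift M K e)"

definition polygonal_mesh :: "mesh \<Rightarrow> bool" where
  "polygonal_mesh M \<longleftrightarrow>
     open (region M) \<and> connected (region M) \<and> bounded (region M) \<and> region M \<noteq> {} \<and>
     finite (cells M) \<and> \<Union>(cells M) = closure (region M) \<and>
     (\<forall>K \<in> cells M. \<forall>K' \<in> cells M. K \<noteq> K' \<longrightarrow> interior K \<inter> interior K' = {}) \<and>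
     (\<forall>K \<in> cells M. polygonal_cell K (edges M K)) \<and>
     (\<forall>K \<in> cells M. \<forall>e \<in> edges M K.
        (let K' = neighbor M K e; e' = opposite_edge M K e in
           K' \<in> cells M \<and> e' \<in> edges M K' \<and>
           neighbor M K' e' = K \<and> shift M K' e' = - shift M K e \<and>
           (shift M K e \<noteq> 0 \<longrightarrow> closed_segment (fst e) (snd e) \<subseteq> frontier (region M))))"

definition area :: "cell \<Rightarrow> real" where
  "area K = measure lebesgue K"

definition cell_average :: "cell \<Rightarrow> (real^2 \<Rightarrow> 'a) \<Rightarrow> 'a::euclidean_space" where
  "cell_average K f = (1 / area K) *\<^sub>R integral K f"


section \<open>Discontinuous piecewise polynomial spaces\<close>

definition poly_deg_le :: "nat \<Rightarrow> (real^2 \<Rightarrow> real) \<Rightarrow> bool" where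
  "poly_deg_le k f \<longleftrightarrow>
     (\<exists>c :: nat \<Rightarrow> nat \<Rightarrow> real. f = (\<lambda>x. \<Sum>i\<le>k. \<Sum>j\<le>k - i. c i j * (x $ 1)^i * (x $ 2)^j))"

definition pderivative :: "2 \<Rightarrow> (real^2 \<Rightarrow> 'a) \<Rightarrow> real^2 \<Rightarrow> 'a::real_normed_vector" where
  "pderivative i f x = vector_derivative (\<lambda>t. f (x + t *\<^sub>R axis i 1)) (at 0)"

(* A piecewise polynomial u is multivalued on edges, so it is represented by the family of its
   restrictions: u K is the polynomial that agrees with u on K.  Its value at a boundary point
   of K is the trace from inside K. *)
type_synonym broken = "cell \<Rightarrow> real^2 \<Rightarrow> state"

definition W_space :: "mesh \<Rightarrow> nat \<Rightarrow> broken set" where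
  "W_space M k = {u. \<forall>K \<in> cells M.
     (\<forall>b \<in> Basis. poly_deg_le k (\<lambda>x. u K x \<bullet> b)) \<and>
     (\<forall>x \<in> K. pderivative 1 (\<lambda>y. mag (u K y) $ 1) x + pderivative 2 (\<lambda>y. mag (u K y) $ 2) x = 0)}"

definition ext_trace :: "mesh \<Rightarrow> broken \<Rightarrow> cell \<Rightarrow> edge \<Rightarrow> real^2 \<Rightarrow> state" where
  "ext_trace M u K e x = u (neighbor M K e) (x + shift M K e)"

definition Gbar_space :: "(real \<Rightarrow> real \<Rightarrow> real) \<Rightarrow> mesh \<Rightarrow> nat \<Rightarrow> broken set" where
  "Gbar_space H M k = {u \<in> W_space M k. \<forall>K \<in> cells M. cell_average K (u K) \<in> admissible H}"

definition G_space :: "(real \<Rightarrow> real \<Rightarrow> real) \<Rightarrow> mesh \<Rightarrow> nat \<Rightarrow> (cell \<Rightarrow> (real^2) set) \<Rightarrow> broken set" where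
  "G_space H M k S = {u \<in> Gbar_space H M k. \<forall>K \<in> cells M. \<forall>x \<in> S K. u K x \<in> admissible H}"


section \<open>Quadratures\<close>

(* All rules are indexed from 1.  gauss_node, gauss_wt: Gauss rule on [0, 1] (weights omega_q).
   vol_num, vol_pt, vol_wt: the rule marked by breve.
   edge_wt, int_num, int_pt, int_wt: the special rule with weights varpi at the edge Gauss points
   and weights varpi-tilde at the remaining nodes. *)
record quadratures =
  gauss_node :: "nat \<Rightarrow> real"
  gauss_wt :: "nat \<Rightarrow> real"
  vol_num :: "cell \<Rightarrow> nat"
  vol_pt :: "cell \<Rightarrow> nat \<Rightarrow> real^2"
  vol_wt :: "cell \<Rightarrow> nat \<Rightarrow> real"
  edge_wt :: "cell \<Rightarrow> edge \<Rightarrow> nat \<Rightarrow> real"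
  int_num :: "cell \<Rightarrow> nat"
  int_pt :: "cell \<Rightarrow> nat \<Rightarrow> real^2"
  int_wt :: "cell \<Rightarrow> nat \<Rightarrow> real"

definition gauss_rule :: "nat \<Rightarrow> (nat \<Rightarrow> real) \<Rightarrow> (nat \<Rightarrow> real) \<Rightarrow> bool" where
  "gauss_rule Q s w \<longleftrightarrow>
     inj_on s {1..Q} \<and> (\<forall>q \<in> {1..Q}. 0 < s q \<and> s q < 1 \<and> w q > 0) \<and> (\<Sum>q=1..Q. w q) = 1 \<and>
     (\<forall>f :: real poly. degree f \<le> 2 * Q - 1 \<longrightarrow>
        (\<Sum>q=1..Q. w q * poly f (s q)) = integral {0..1} (poly f))"

definition edge_pt :: "quadratures \<Rightarrow> edge \<Rightarrow> nat \<Rightarrow> real^2" where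
  "edge_pt R e q = fst e + gauss_node R q *\<^sub>R (snd e - fst e)"

definition vol_rule :: "nat \<Rightarrow> quadratures \<Rightarrow> cell \<Rightarrow> bool" where
  "vol_rule k R K \<longleftrightarrow>
     (\<forall>q \<in> {1..vol_num R K}. vol_pt R K q \<in> K) \<and>
     (\<forall>f. poly_deg_le (2 * k) f \<longrightarrow>
        cell_average K f = (\<Sum>q=1..vol_num R K. vol_wt R K q * f (vol_pt R K q)))"

definition special_rule :: "nat \<Rightarrow> mesh \<Rightarrow> quadratures \<Rightarrow> cell \<Rightarrow> bool" where
  "special_rule k M R K \<longleftrightarrow>
     (\<forall>e \<in> edges M K. \<forall>q \<in> {1..k+1}. edge_wt R K e q > 0) \<and>
     (\<forall>q \<in> {1..int_num R K}. int_wt R K q > 0 \<and> int_pt R K q \<in> K) \<and>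
     (\<Sum>e \<in> edges M K. \<Sum>q=1..k+1. edge_wt R K e q) + (\<Sum>q=1..int_num R K. int_wt R K q) = 1 \<and>
     (\<forall>f. poly_deg_le k f \<longrightarrow>
        cell_average K f =
          (\<Sum>e \<in> edges M K. \<Sum>q=1..k+1. edge_wt R K e q * f (edge_pt R e q))
          + (\<Sum>q=1..int_num R K. int_wt R K q * f (int_pt R K q)))"

definition admissible_quadratures :: "nat \<Rightarrow> mesh \<Rightarrow> quadratures \<Rightarrow> bool" where
  "admissible_quadratures k M R \<longleftrightarrow>
     gauss_rule (k + 1) (gauss_node R) (gauss_wt R) \<and>
     (\<forall>K \<in> cells M. vol_rule k R K \<and> special_rule k M R K)"

definition S_hat :: "nat \<Rightarrow> mesh \<Rightarrow> quadratures \<Rightarrow> cell \<Rightarrow> (real^2) set" where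
  "S_hat k M R K =
     {edge_pt R e q | e q. e \<in> edges M K \<and> q \<in> {1..k+1}} \<union> int_pt R K ` {1..int_num R K}"

definition S_breve :: "quadratures \<Rightarrow> cell \<Rightarrow> (real^2) set" where
  "S_breve R K = vol_pt R K ` {1..vol_num R K}"


section \<open>The discontinuous Galerkin operator\<close>

definition J_form :: "(real \<Rightarrow> real \<Rightarrow> real) \<Rightarrow> mesh \<Rightarrow> nat \<Rightarrow> quadratures \<Rightarrow> cell \<Rightarrow> broken \<Rightarrow> broken \<Rightarrow> real" where
  "J_form H M k R K U u =
     - (\<Sum>e \<in> edges M K. edge_length e * (\<Sum>q=1..k+1. gauss_wt R q *
          (let x = edge_pt R e q; n = edge_normal e;
               Ui = U K x; Ue = ext_trace M U K e x
           in (num_flux H Ui Ue n + ((1/2) * ndotB n (mag Ue - mag Ui)) *\<^sub>R source H Ui) \<bullet> u K x)))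
     + area K * (\<Sum>q=1..vol_num R K. vol_wt R K q *
          (let x = vol_pt R K q
           in flux H 1 (U K x) \<bullet> pderivative 1 (u K) x + flux H 2 (U K x) \<bullet> pderivative 2 (u K) x))"

(* L is L_h(U).  The defining identity determines L K on K uniquely for every cell K. *)
definition is_L_h :: "(real \<Rightarrow> real \<Rightarrow> real) \<Rightarrow> mesh \<Rightarrow> nat \<Rightarrow> quadratures \<Rightarrow> broken \<Rightarrow> broken \<Rightarrow> bool" where
  "is_L_h H M k R U L \<longleftrightarrow> L \<in> W_space M k \<and>
     (\<forall>u \<in> W_space M k. \<forall>K \<in> cells M. integral K (\<lambda>x. L K x \<bullet> u K x) = J_form H M k R K U u)"

definition sigma :: "(real \<Rightarrow> real \<Rightarrow> real) \<Rightarrow> mesh \<Rightarrow> quadratures \<Rightarrow> broken \<Rightarrow> cell \<Rightarrow> edge \<Rightarrow> nat \<Rightarrow> real" where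
  "sigma H M R U K e q =
     (let x = edge_pt R e q; Ui = U K x; Ue = ext_trace M U K e x
      in (1/2) * \<bar>ndotB (edge_normal e) (mag Ui - mag Ue)\<bar> / sqrt (density H Ui * enthalpy H Ui))"

end

theory Submission
  imports Defs
begin

text \<open>Admissibility has a dual description: \<open>U\<close> is admissible iff its density component is positive and
  \<open>U \<bullet> nstar w b + mag_pressure w b > 0\<close> for all \<open>b\<close> and all \<open>w\<close> with \<open>norm w < 1\<close>,
  a family of conditions that are affine in \<open>U\<close>.  For an admissible \<open>U\<close> and a unit normal \<open>n\<close>,
  \<open>(U - \<langle>n,F(U)\<rangle>) \<bullet> nstar w b + mag_pressure w b\<close> is bounded below by
  \<open>(n \<bullet> w) * mag_pressure w b - \<langle>n,B\<rangle> * (w \<bullet> b)\<close>, which can be negative.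
  The source term turns the mean of the two traces of \<open>\<langle>n,B\<rangle>\<close> on an edge into the interior trace, at a cost
  controlled by \<open>sigma\<close>.  Summed over the edges of a cell, the lower bounds then cancel: the scaled normals of a closed polygon add up
  to zero, and the flux of the divergence-free polynomial \<open>B\<close> vanishes and is computed exactly by the Gauss rule.
  What remains of the updated cell average is a combination of admissible point values whose coefficients are positive by the CFL
  condition.\<close>

section \<open>Algebraic inequalities\<close>

text \<open>\<open>nstar w b\<close> is normal to a hyperplane that touches the admissible set at
  its cold limit states (p = 0, H = 1) of velocity w and field b. There
  \<open>U \<bullet> nstar w b + mag_pressure w b\<close> vanishes; at an admissible state, with w
  and b its own velocity and field, it equals rho times the internal energy. Without these
  hyperplanes, membership is implicit in a nonlinear recovery of the primitive variables and cannot
  be averaged; conditions affine in U can. The hyperplanes see only cold states, so the converse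
  must reach every state on their positive side. This is where the assumption enters that the
  internal energy tends to 0 with p: it excludes a gap between the cold states and the attained
  ones. In the converse, b is just the field of the state to be recovered.

  A discrete obstacle concerns the exterior traces: they are known to be admissible only at the
  Gauss points of the neighbour, which traverses the common edge backwards. The Gauss nodes must
  therefore be symmetric about 1/2, and this is derived from the exactness of the rule.\<close>

definition mag_pressure :: "real^3 \<Rightarrow> real^3 \<Rightarrow> real" where
  "mag_pressure w b = ((1 - w \<bullet> w) * (b \<bullet> b) + (w \<bullet> b)^2) / 2"

text \<open>The first entry is minus the inverse Lorentz factor of w. The third entry is minus the
  gradient of \<open>mag_pressure w\<close> at b. This makes the terms in b a quadratic whose
  minimum can be found by completing the square.\<close>

definition nstar :: "real^3 \<Rightarrow> real^3 \<Rightarrow> state" where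
  "nstar w b = (- sqrt (1 - w \<bullet> w), - w, - ((1 - w \<bullet> w) *\<^sub>R b + (w \<bullet> b) *\<^sub>R w), 1)"

text \<open>A Gram determinant of three vectors in space; it is the square of their triple
  product.\<close>

lemma gram_nonneg:
  fixes x y z :: "real^3"
  shows "(x \<bullet> x) * (y \<bullet> y) * (z \<bullet> z) + 2 * (x \<bullet> y) * (y \<bullet> z) * (x \<bullet> z)
     - (x \<bullet> x) * (y \<bullet> z)^2 - (y \<bullet> y) * (x \<bullet> z)^2 - (z \<bullet> z) * (x \<bullet> y)^2 \<ge> 0"
proof -
  have "(x \<bullet> x) * (y \<bullet> y) * (z \<bullet> z) + 2 * (x \<bullet> y) * (y \<bullet> z) * (x \<bullet> z)
     - (x \<bullet> x) * (y \<bullet> z)^2 - (y \<bullet> y) * (x \<bullet> z)^2 - (z \<bullet> z) * (x \<bullet> y)^2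
     = (x$1 * (y$2 * z$3 - y$3 * z$2) - x$2 * (y$1 * z$3 - y$3 * z$1) + x$3 * (y$1 * z$2 - y$2 * z$1))^2"
    unfolding inner_vec_def sum_3 inner_real_def by algebra
  then show ?thesis by simp
qed

text \<open>Four vectors in a space of dimension three are dependent, so their Gram determinant
  vanishes; the identity is its expansion along the row and column of n.\<close>

lemma gram4_eq_0:
  fixes n v w B :: "real^3"
  shows "(n \<bullet> n) * ((v \<bullet> v) * (w \<bullet> w) * (B \<bullet> B) + 2 * (v \<bullet> w) * (v \<bullet> B) * (w \<bullet> B)
      - (v \<bullet> v) * (w \<bullet> B)^2 - (w \<bullet> w) * (v \<bullet> B)^2 - (B \<bullet> B) * (v \<bullet> w)^2)
    = (n \<bullet> v)^2 * ((w \<bullet> w) * (B \<bullet> B) - (w \<bullet> B)^2) + (n \<bullet> w)^2 * ((v \<bullet> v) * (B \<bullet> B) - (v \<bullet> B)^2)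
      + (n \<bullet> B)^2 * ((v \<bullet> v) * (w \<bullet> w) - (v \<bullet> w)^2)
      - 2 * (n \<bullet> v) * (n \<bullet> w) * ((v \<bullet> w) * (B \<bullet> B) - (v \<bullet> B) * (w \<bullet> B))
      - 2 * (n \<bullet> v) * (n \<bullet> B) * ((v \<bullet> B) * (w \<bullet> w) - (v \<bullet> w) * (w \<bullet> B))
      - 2 * (n \<bullet> w) * (n \<bullet> B) * ((w \<bullet> B) * (v \<bullet> v) - (v \<bullet> w) * (v \<bullet> B))"
  unfolding inner_vec_def sum_3 inner_real_def by algebra

text \<open>With x = p / rho, squaring \<open>h - x \<ge> sqrt (1 + x^2)\<close> removes the root;
  the quadratic form is what the gas estimates use.\<close>

lemma enthalpy_quadratic_bound:
  fixes x h :: real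
  assumes "x > 0" "h \<ge> sqrt (1 + x^2) + x"
  shows "2 * h * x \<le> h^2 - 1" "h > 1 + x"
proof -
  have s: "sqrt (1 + x^2) > 1" using assms(1) by simp
  then show "h > 1 + x" using assms by linarith
  have "1 + x^2 = (sqrt (1 + x^2))^2" by simp
  also have "\<dots> \<le> (h - x)^2" using assms s by (intro power_mono) auto
  finally show "2 * h * x \<le> h^2 - 1" by (simp add: power2_eq_square algebra_simps)
qed

text \<open>In use a and a' are the inverse Lorentz factors of v and w,
  \<open>g = 1 - v \<bullet> w\<close>, and k, k' are either 1 or \<open>1 + n \<bullet> v\<close>,
  \<open>1 + n \<bullet> w\<close>. The factor 2 h k' splits the gas part into three terms that are
  nonnegative for separate reasons: a Cauchy-Schwarz gap, a square, and the slack in the equation of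
  state.\<close>

lemma gas_identity:
  fixes h x a a' k k' g :: real
  shows "2 * h * k' * (h * k * g - x * k' * a^2 - k * a * a')
    = h^2 * (2 * k * k' * g - k'^2 * a^2 - k^2 * a'^2) + (h * k * a' - k' * a)^2
      + (h^2 - 1 - 2 * h * x) * k'^2 * a^2"
  by algebra

lemma gas_flux_nonneg:
  fixes h x a a' k k' g :: real
  assumes "h > 0" "2 * h * x \<le> h^2 - 1" "k' > 0" "k'^2 * a^2 + k^2 * a'^2 \<le> 2 * k * k' * g"
  shows "h * k * g - x * k' * a^2 - k * a * a' \<ge> 0"
proof -
  have "2 * h * k' * (h * k * g - x * k' * a^2 - k * a * a') \<ge> 0"
    unfolding gas_identity using assms by (intro add_nonneg_nonneg mult_nonneg_nonneg) auto
  moreover have "2 * h * k' > 0" using assms by simp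
  ultimately show ?thesis by (meson zero_le_mult_iff not_less)
qed

text \<open>Strictness: either the Cauchy-Schwarz gap is positive, or a' = a and the square in
  \<open>gas_identity\<close> becomes ((h - 1) a)^2, which is positive because h > 1.\<close>

lemma gas_energy_pos:
  fixes h x a a' g :: real
  assumes "h > 1" "2 * h * x \<le> h^2 - 1" "a > 0" "a^2 + a'^2 \<le> 2 * g" "a^2 + a'^2 = 2 * g \<Longrightarrow> a' = a"
  shows "h * g - x * a^2 - a * a' > 0"
proof -
  have "h^2 * (2 * g - a^2 - a'^2) + (h * a' - a)^2 > 0"
  proof (cases "a^2 + a'^2 = 2 * g")
    case True
    then have "h * a' - a \<noteq> 0" using assms by auto
    then have "(h * a' - a)^2 > 0" by simp
    moreover have "2 * g - a^2 - a'^2 = 0" using True by simp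
    ultimately show ?thesis by (simp del: zero_less_power2)
  next
    case False
    then have "h^2 * (2 * g - a^2 - a'^2) > 0" using assms by (intro mult_pos_pos) auto
    then show ?thesis by (simp add: add_pos_nonneg)
  qed
  moreover have "(h^2 - 1 - 2 * h * x) * a^2 \<ge> 0" using assms by simp
  ultimately have "2 * h * (h * g - x * a^2 - a * a') > 0"
    using gas_identity[of h 1 1 g x a a'] by simp
  then show ?thesis using assms by (simp add: zero_less_mult_iff)
qed

text \<open>Keeps a quantitative part of the Cauchy-Schwarz gap instead of only its sign. After
  multiplication by rho / a^2 the right side is rho h |w - v|^2, the amount that pays for the source
  term.\<close>

lemma gas_source_bound:
  fixes h x a a' g :: real
  assumes "h > 0" "2 * h * x \<le> h^2 - 1" "a^2 \<le> 1" "a^2 + a'^2 \<le> 2 * g"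
  shows "2 * (h * g - x * a^2 - a * a') \<ge> h * a^2 * (2 * g - a^2 - a'^2)"
proof -
  have "h * (2 * (h * g - x * a^2 - a * a') - h * a^2 * (2 * g - a^2 - a'^2))
    = h^2 * (1 - a^2) * (2 * g - a^2 - a'^2) + (h * a' - a)^2 + (h^2 - 1 - 2 * h * x) * a^2"
    by algebra
  also have "\<dots> \<ge> 0" using assms by (intro add_nonneg_nonneg mult_nonneg_nonneg) auto
  finally show ?thesis using assms(1) by (simp add: zero_le_mult_iff)
qed

section \<open>Estimates for the magnetic part\<close>

lemma inner_less_one:
  fixes v w :: "'a::real_inner"
  assumes "norm v < 1" "norm w \<le> 1"
  shows "v \<bullet> w > -1" "v \<bullet> w < 1"
proof -
  have "\<bar>v \<bullet> w\<bar> \<le> norm v * norm w" by (rule Cauchy_Schwarz_ineq2)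
  also have "\<dots> \<le> norm v * 1" using assms by (intro mult_left_mono) auto
  finally show "v \<bullet> w > -1" "v \<bullet> w < 1" using assms by auto
qed

lemma inner_self_less_one: "norm v < 1 \<Longrightarrow> v \<bullet> v < 1" for v :: "'a::real_inner"
  by (simp add: dot_square_norm abs_square_less_1)

text \<open>The right side is the minimum over b of the left side, attained at b = z / k.\<close>

lemma mag_pressure_completed_square:
  fixes w b z :: "real^3"
  assumes "k > 0"  "norm w < 1"
  shows "k * mag_pressure w b - ((1 - w \<bullet> w) *\<^sub>R b + (w \<bullet> b) *\<^sub>R w) \<bullet> z
     \<ge> - ((1 - w \<bullet> w) * (z \<bullet> z) + (w \<bullet> z)^2) / (2 * k)"
proof -
  let ?d = "k *\<^sub>R b - z"
  have "2 * k * (k * mag_pressure w b - ((1 - w \<bullet> w) *\<^sub>R b + (w \<bullet> b) *\<^sub>R w) \<bullet> z)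
     + ((1 - w \<bullet> w) * (z \<bullet> z) + (w \<bullet> z)^2) = (1 - w \<bullet> w) * (?d \<bullet> ?d) + (w \<bullet> ?d)^2"
    unfolding mag_pressure_def inner_add_left inner_diff_left inner_diff_right inner_scaleR_left inner_scaleR_right
      inner_commute[of z b] by algebra
  also have "\<dots> \<ge> 0" using inner_self_less_one[OF assms(2)] by simp
  finally have "2 * k * (k * mag_pressure w b - ((1 - w \<bullet> w) *\<^sub>R b + (w \<bullet> b) *\<^sub>R w) \<bullet> z)
     \<ge> - ((1 - w \<bullet> w) * (z \<bullet> z) + (w \<bullet> z)^2)" by linarith
  then show ?thesis using assms(1) by (simp add: pos_divide_le_eq mult_ac)
qed

text \<open>Minimising over b leaves an inequality in n, v, w, B. Multiplied by
  \<open>2 * (1 + n \<bullet> w)\<close>, its slack is the Gram determinant of B, n + v and w - v;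
  the identity behind this holds modulo the vanishing Gram determinant of n, v, w, B.\<close>

lemma magnetic_flux_bound:
  fixes v w B n b :: "real^3"
  assumes "norm n = 1" "norm v < 1" "norm w < 1"
  shows "(1 + n \<bullet> v) * ((B \<bullet> B) * (1 - v \<bullet> w) + (v \<bullet> B) * (w \<bullet> B)) - (v \<bullet> B) * (n \<bullet> B)
      + (n \<bullet> B) * ((1 - v \<bullet> v) * (w \<bullet> B) + (v \<bullet> B) * (v \<bullet> w)) - (1 + n \<bullet> w) * mag_pressure v B
      - ((1 - w \<bullet> w) *\<^sub>R b + (w \<bullet> b) *\<^sub>R w) \<bullet> ((1 + n \<bullet> v) *\<^sub>R B - (n \<bullet> B) *\<^sub>R v)
      + (1 + n \<bullet> w) * mag_pressure w b - (n \<bullet> B) * (w \<bullet> b) \<ge> 0" (is "?M - ?C \<bullet> ?y + ?k * mag_pressure w b - _ \<ge> 0")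
proof -
  \<comment> \<open>The vector multiplying z in the completed square has inner product
    \<open>w \<bullet> b\<close> with w, so this shift absorbs the term
    \<open>(n \<bullet> B) * (w \<bullet> b)\<close>.\<close>
  let ?z = "?y + (n \<bullet> B) *\<^sub>R w"
  have k: "?k > 0" using inner_less_one[of w n] assms by (simp add: inner_commute)
  have n1: "n \<bullet> n = 1" using assms(1) by (simp add: dot_square_norm)
  have c: "?C \<bullet> ?z = ?C \<bullet> ?y + (n \<bullet> B) * (w \<bullet> b)"
    unfolding inner_add_left inner_diff_left inner_add_right inner_diff_right inner_scaleR_left inner_scaleR_right
      inner_commute[of b w] by algebra
  have z: "?k * mag_pressure w b - ?C \<bullet> ?z \<ge> - ((1 - w \<bullet> w) * (?z \<bullet> ?z) + (w \<bullet> ?z)^2) / (2 * ?k)"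
    by (rule mag_pressure_completed_square[OF k assms(3)])
  have "2 * ?k * ?M - ((1 - w \<bullet> w) * (?z \<bullet> ?z) + (w \<bullet> ?z)^2) =
     (let x = B; y = n + v; z = w - v in (x \<bullet> x) * (y \<bullet> y) * (z \<bullet> z) + 2 * (x \<bullet> y) * (y \<bullet> z) * (x \<bullet> z)
     - (x \<bullet> x) * (y \<bullet> z)^2 - (y \<bullet> y) * (x \<bullet> z)^2 - (z \<bullet> z) * (x \<bullet> y)^2)"
    unfolding Let_def mag_pressure_def inner_add_left inner_diff_left inner_add_right inner_diff_right inner_scaleR_left
      inner_scaleR_right inner_commute[of B v] inner_commute[of B w] inner_commute[of B n]
      inner_commute[of w v] inner_commute[of v n] inner_commute[of w n] n1
    using gram4_eq_0[of n v w B, unfolded n1] by algebra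
  then have "2 * ?k * ?M \<ge> ((1 - w \<bullet> w) * (?z \<bullet> ?z) + (w \<bullet> ?z)^2)"
    using gram_nonneg[of B "n + v" "w - v"] by (simp add: Let_def)
  then have "?M \<ge> ((1 - w \<bullet> w) * (?z \<bullet> ?z) + (w \<bullet> ?z)^2) / (2 * ?k)"
    using k by (simp add: pos_divide_le_eq mult_ac)
  with z c show ?thesis by linarith
qed

text \<open>The factor of e is what the source term contributes. The loss on the right is quadratic
  in e and proportional to |w - v|^2, so the gas part can compensate it for a suitable e, which is
  left free here.\<close>

lemma magnetic_source_bound:
  fixes v w B b :: "real^3" and e :: real
  assumes "norm w < 1"
  shows "(B \<bullet> B) * (1 - v \<bullet> w) + (v \<bullet> B) * (w \<bullet> B) - mag_pressure v B
      - ((1 - w \<bullet> w) *\<^sub>R b + (w \<bullet> b) *\<^sub>R w) \<bullet> B + mag_pressure w b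
      + e * ((v \<bullet> B) * (1 - v \<bullet> w) - (1 - v \<bullet> v) * (w \<bullet> B) + (w \<bullet> b) * (1 - v \<bullet> w) - (1 - w \<bullet> w) * (v \<bullet> b))
    \<ge> - (e^2 * ((w - v) \<bullet> (w - v)) / 2)" (is "?M - ?C \<bullet> B + mag_pressure w b + e * (?T + ?T2 - ?T3) \<ge> _")
proof -
  let ?z = "B - e *\<^sub>R (w - v)"
  have c: "?C \<bullet> ?z = ?C \<bullet> B - e * (?T2 - ?T3)"
    unfolding inner_add_left inner_diff_left inner_add_right inner_diff_right inner_scaleR_left inner_scaleR_right
      inner_commute[of b w] inner_commute[of b v] inner_commute[of w v] by algebra
  have z: "1 * mag_pressure w b - ?C \<bullet> ?z \<ge> - ((1 - w \<bullet> w) * (?z \<bullet> ?z) + (w \<bullet> ?z)^2) / (2 * 1)"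
    by (rule mag_pressure_completed_square[OF _ assms]) simp
  \<comment> \<open>After b is eliminated, the remaining slack is the squared length of this
    vector.\<close>
  let ?q = "cross3 B (w - v) + e *\<^sub>R cross3 v w"
  have "2 * (?M + e * ?T) - ((1 - w \<bullet> w) * (?z \<bullet> ?z) + (w \<bullet> ?z)^2) + e^2 * ((w - v) \<bullet> (w - v)) = ?q \<bullet> ?q"
    unfolding mag_pressure_def inner_vec_def sum_3 inner_real_def cross3_def vector_add_component vector_minus_component
      vector_scaleR_component vector_3 real_scaleR_def by algebra
  also have "\<dots> \<ge> 0" by simp
  finally have q: "0 \<le> 2 * (?M + e * ?T) - ((1 - w \<bullet> w) * (?z \<bullet> ?z) + (w \<bullet> ?z)^2) + e^2 * ((w - v) \<bullet> (w - v))" .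
  have "e * (?T + ?T2 - ?T3) = e * ?T + e * (?T2 - ?T3)" by (simp add: algebra_simps)
  moreover have "- (E / 2) \<le> M - CB + r + e1"
    if "e1 = eT + eS" "- Z / (2 * 1) \<le> 1 * r - CZ" "CZ = CB - eS" "0 \<le> 2 * (M + eT) - Z + E"
    for E M CB r e1 eT eS Z CZ :: real using that by simp
  ultimately show ?thesis using z c q by blast
qed

section \<open>Flux and source estimates on admissible states\<close>

lemma lorentz_square:
  assumes "norm v < 1"
  shows "(lorentz v)^2 = 1 / (1 - v \<bullet> v)"
  using inner_self_less_one[OF assms] by (simp add: lorentz_def power_divide flip: dot_square_norm)

lemma p_tot_eq:
  assumes "norm v < 1"
  shows "p_tot (\<rho>, v, B, p) = p + mag_pressure v B"
  by (simp add: p_tot_def lorentz_square[OF assms] mag_pressure_def power2_norm_eq_inner algebra_simps)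

lemma conserved_eq:
  assumes "norm v < 1"
  shows "conserved H (\<rho>, v, B, p) = (\<rho> / sqrt (1 - v \<bullet> v),
      (\<rho> * H p \<rho> / (1 - v \<bullet> v) + B \<bullet> B) *\<^sub>R v - (v \<bullet> B) *\<^sub>R B, B,
      \<rho> * H p \<rho> / (1 - v \<bullet> v) - (p + mag_pressure v B) + B \<bullet> B)"
  unfolding conserved_def Let_def prod.case lorentz_square[OF assms] p_tot_eq[OF assms] power2_norm_eq_inner
  by (simp add: lorentz_def power2_norm_eq_inner)

lemma admissible_cases:
  assumes "U \<in> admissible H" "eos H"
  obtains \<rho> v B p where "prim_of H U = (\<rho>, v, B, p)" "\<rho> > 0" "p > 0" "norm v < 1"
    "U = conserved H (\<rho>, v, B, p)" "H p \<rho> > 1" "2 * H p \<rho> * (p / \<rho>) \<le> (H p \<rho>)^2 - 1"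
proof -
  obtain \<rho> v B p where q: "prim_of H U = (\<rho>, v, B, p)" by (metis prod_cases4)
  have "prim_of H U \<in> admissible_prim H" "conserved H (prim_of H U) = U"
    using assms(1) unfolding admissible_def prim_of_def by (auto intro: inv_into_into f_inv_into_f)
  then have *: "\<rho> > 0" "p > 0" "norm v < 1" "U = conserved H (\<rho>, v, B, p)"
    by (auto simp: q admissible_prim_def)
  then have x: "p / \<rho> > 0" "H p \<rho> \<ge> sqrt (1 + (p / \<rho>)^2) + p / \<rho>"
    using assms(2) by (auto simp: eos_def power_divide)
  show thesis
    using enthalpy_quadratic_bound[OF x] x(1) by (intro that[OF q *]) linarith+
qed

text \<open>Separates a gas part, free of B and b, from a magnetic part, free of rho and p, so that
  the two can be estimated independently.\<close>

lemma energy_decomposition: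
  assumes "norm v < 1"
  shows "conserved H (\<rho>, v, B, p) \<bullet> nstar w b + mag_pressure w b =
    (\<rho> * H p \<rho> / (1 - v \<bullet> v) * (1 - v \<bullet> w) - p - \<rho> / sqrt (1 - v \<bullet> v) * sqrt (1 - w \<bullet> w))
    + ((B \<bullet> B) * (1 - v \<bullet> w) + (v \<bullet> B) * (w \<bullet> B) - mag_pressure v B
      - ((1 - w \<bullet> w) *\<^sub>R b + (w \<bullet> b) *\<^sub>R w) \<bullet> B + mag_pressure w b)"
proof -
  define Z D a' where "Z = \<rho> * H p \<rho> / (1 - v \<bullet> v)" and "D = \<rho> / sqrt (1 - v \<bullet> v)" and "a' = sqrt (1 - w \<bullet> w)"
  show ?thesis
    unfolding conserved_eq[OF assms] nstar_def inner_Pair Z_def[symmetric] D_def[symmetric] a'_def[symmetric]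
      inner_diff_left inner_add_left inner_minus_right inner_add_right inner_scaleR_left inner_scaleR_right inner_real_def
      inner_commute[of B w] inner_commute[of B b] by algebra
qed

lemma gas_scaled:
  fixes a a' h p \<rho> g :: real
  assumes "\<rho> > 0" "a > 0"
  shows "\<rho> * h / a^2 * k * g - p * k' - \<rho> / a * k * a' = \<rho> / a^2 * (h * k * g - p / \<rho> * k' * a^2 - k * a * a')"
  using assms by (simp add: field_simps power2_eq_square)

lemma quadratic_gap:
  fixes v w :: "'a::real_inner"
  shows "2 * (1 - v \<bullet> w) - (1 - v \<bullet> v) - (1 - w \<bullet> w) = (w - v) \<bullet> (w - v)"
  by (simp add: inner_diff_left inner_diff_right inner_commute)

text \<open>Strict positivity comes from the gas part; the magnetic part is only nonnegative, since
  it vanishes at w = v, b = B.\<close>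

lemma admissible_energy_pos:
  assumes U: "U \<in> admissible H" and "eos H" and w: "norm w < 1"
  shows "U \<bullet> nstar w b + mag_pressure w b > 0"
proof -
  obtain \<rho> v B p where q: "\<rho> > 0" "p > 0" and v: "norm v < 1"
    and U: "U = conserved H (\<rho>, v, B, p)" and h: "H p \<rho> > 1" "2 * H p \<rho> * (p / \<rho>) \<le> (H p \<rho>)^2 - 1"
    using admissible_cases[OF assms(1,2)] by metis
  define a a' where "a = sqrt (1 - v \<bullet> v)" and "a' = sqrt (1 - w \<bullet> w)"
  have a: "a > 0" "a^2 = 1 - v \<bullet> v" "a'^2 = 1 - w \<bullet> w"
    unfolding a_def a'_def using inner_self_less_one[OF v] inner_self_less_one[OF w] by auto
  have gap: "2 * (1 - v \<bullet> w) - a^2 - a'^2 = (w - v) \<bullet> (w - v)"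
    unfolding a quadratic_gap ..
  have "H p \<rho> * (1 - v \<bullet> w) - p / \<rho> * a^2 - a * a' > 0"
  proof (rule gas_energy_pos)
    show "a^2 + a'^2 \<le> 2 * (1 - v \<bullet> w)" using gap inner_ge_zero[of "w - v"] by linarith
    assume "a^2 + a'^2 = 2 * (1 - v \<bullet> w)"
    then have "(w - v) \<bullet> (w - v) = 0" using gap by linarith
    then have "w = v" by simp
    then show "a' = a" unfolding a_def a'_def by simp
  qed (use a h in auto)
  then have "\<rho> * H p \<rho> / a^2 * (1 - v \<bullet> w) - p - \<rho> / a * a' > 0"
    using gas_scaled[of \<rho> a "H p \<rho>" 1 "1 - v \<bullet> w" p 1 a'] q a(1) by simp
  moreover have "(B \<bullet> B) * (1 - v \<bullet> w) + (v \<bullet> B) * (w \<bullet> B) - mag_pressure v B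
      - ((1 - w \<bullet> w) *\<^sub>R b + (w \<bullet> b) *\<^sub>R w) \<bullet> B + mag_pressure w b \<ge> 0"
    \<comment> \<open>At e = 0 the source bound reduces to nonnegativity of the magnetic
      part.\<close>
    using magnetic_source_bound[OF w, where B = B and v = v and b = b and e = 0] by simp
  ultimately show ?thesis unfolding U energy_decomposition[OF v] a_def[symmetric] a'_def[symmetric] unfolding a(2)[symmetric] by linarith
qed

text \<open>Planar normals are lifted to space so that the flux estimates can be proved for an
  arbitrary unit vector of \<open>real^3\<close>.\<close>

definition embed :: "real^2 \<Rightarrow> real^3" where
  "embed n = vector [n $ 1, n $ 2, 0]"

lemma embed_minus: "embed (- n) = - embed n"
  by (simp add: embed_def vec_eq_iff forall_3)

lemma norm_embed: "norm (embed n) = norm n"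
  by (simp add: embed_def norm_eq_sqrt_inner inner_vec_def sum_3 sum_2)

lemma ndotB_eq: "ndotB n B = embed n \<bullet> B"
  by (simp add: embed_def ndotB_def inner_vec_def sum_3)

lemma ndotF_eq:
  assumes "prim_of H U = (\<rho>, v, B, p)" "U = conserved H (\<rho>, v, B, p)" "norm v < 1" "U = (D, m, B', E)"
  shows "ndotF H n U = ((embed n \<bullet> v) * D,
     (embed n \<bullet> v) *\<^sub>R m - (embed n \<bullet> B) *\<^sub>R ((1 - v \<bullet> v) *\<^sub>R B + (v \<bullet> B) *\<^sub>R v) + (p + mag_pressure v B) *\<^sub>R embed n,
     (embed n \<bullet> v) *\<^sub>R B - (embed n \<bullet> B) *\<^sub>R v,
     embed n \<bullet> m)"
proof -
  have B: "B' = B" using assms(2,4) unfolding conserved_eq[OF assms(3)] by auto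
  have W: "1 / (lorentz v)^2 = 1 - v \<bullet> v" using lorentz_square[OF assms(3)] by simp
  have f: "flux H i U = (D * v $ i,
      v $ i *\<^sub>R m - B $ i *\<^sub>R ((1 - v \<bullet> v) *\<^sub>R B + (v \<bullet> B) *\<^sub>R v) + (p + mag_pressure v B) *\<^sub>R axis i 1,
      v $ i *\<^sub>R B - B $ i *\<^sub>R v, m $ i)" for i
    using assms(1) p_tot_eq[OF assms(3)] unfolding flux_def Let_def velocity_def assms(4) B prod.case
    by (simp add: W)
  show ?thesis unfolding ndotF_def f
    by (simp add: embed_def vec_eq_iff forall_3 inner_vec_def[of "vector _"] sum_3 axis_def algebra_simps)
qed

text \<open>Adding the flux weights the transported terms by \<open>k = 1 + n \<bullet> v\<close>
  and the pressure p by \<open>k' = 1 + n \<bullet> w\<close>. Both are positive because all speeds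
  are below 1, the value of \<open>a_visc\<close>. Gas and magnetic parts then separate as
  before.\<close>

lemma flux_dual_nonneg:
  assumes U: "U \<in> admissible H" and "eos H" and w: "norm w < 1" and n: "norm n = 1"
  shows "(U + ndotF H n U) \<bullet> nstar w b + mag_pressure w b + (embed n \<bullet> w) * mag_pressure w b - ndotB n (mag U) * (w \<bullet> b) \<ge> 0"
proof -
  obtain \<rho> v B p where prim: "prim_of H U = (\<rho>, v, B, p)" and q: "\<rho> > 0" "p > 0" and v: "norm v < 1"
    and U: "U = conserved H (\<rho>, v, B, p)" and h: "H p \<rho> > 1" "2 * H p \<rho> * (p / \<rho>) \<le> (H p \<rho>)^2 - 1"
    using admissible_cases[OF assms(1,2)] by metis
  define a a' where "a = sqrt (1 - v \<bullet> v)" and "a' = sqrt (1 - w \<bullet> w)"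
  have a: "a > 0" "a^2 = 1 - v \<bullet> v" "a'^2 = 1 - w \<bullet> w"
    unfolding a_def a'_def using inner_self_less_one[OF v] inner_self_less_one[OF w] by auto
  define N where "N = embed n"
  have N: "norm N = 1" using n by (simp add: N_def norm_embed)
  have mB: "mag U = B" unfolding U conserved_eq[OF v] by (simp add: mag_def)
  define k k' where "k = 1 + N \<bullet> v" and "k' = 1 + N \<bullet> w"
  have kp: "k > 0" "k' > 0" unfolding k_def k'_def
    using inner_less_one(1)[of v N] inner_less_one(1)[of w N] v w N by (simp_all add: inner_commute)
  \<comment> \<open>Cauchy-Schwarz for this combination is exactly the gap condition of
    \<open>gas_flux_nonneg\<close>, since its component along N is k - k'.\<close>
  have "\<bar>N \<bullet> (k' *\<^sub>R v - k *\<^sub>R w)\<bar> \<le> norm N * norm (k' *\<^sub>R v - k *\<^sub>R w)" by (rule Cauchy_Schwarz_ineq2)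
  then have "(N \<bullet> (k' *\<^sub>R v - k *\<^sub>R w))^2 \<le> (norm (k' *\<^sub>R v - k *\<^sub>R w))^2"
    using N by (simp add: abs_le_square_iff[symmetric])
  moreover have "N \<bullet> (k' *\<^sub>R v - k *\<^sub>R w) = k - k'"
    unfolding inner_diff_right inner_scaleR_right k_def k'_def by algebra
  moreover have "(norm (k' *\<^sub>R v - k *\<^sub>R w))^2 = k'^2 * (v \<bullet> v) - 2 * k * k' * (v \<bullet> w) + k^2 * (w \<bullet> w)"
    unfolding power2_norm_eq_inner inner_diff_right inner_diff_left inner_scaleR_right inner_scaleR_left
      inner_commute[of w v] by algebra
  ultimately have "(k - k')^2 \<le> k'^2 * (v \<bullet> v) - 2 * k * k' * (v \<bullet> w) + k^2 * (w \<bullet> w)"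
    by metis
  then have "k'^2 * a^2 + k^2 * a'^2 \<le> 2 * k * k' * (1 - v \<bullet> w)"
    unfolding a by (simp add: algebra_simps power2_eq_square)
  then have "H p \<rho> * k * (1 - v \<bullet> w) - p / \<rho> * k' * a^2 - k * a * a' \<ge> 0"
    using h kp by (intro gas_flux_nonneg) auto
  then have gas: "\<rho> * H p \<rho> / a^2 * k * (1 - v \<bullet> w) - p * k' - \<rho> / a * k * a' \<ge> 0"
    using gas_scaled[of \<rho> a "H p \<rho>" k "1 - v \<bullet> w" p k' a'] q a(1) by simp
  define Z D where "Z = \<rho> * H p \<rho> / a^2" and "D = \<rho> / a"
  have "(U + ndotF H n U) \<bullet> nstar w b =
     (\<rho> * H p \<rho> / a^2 * k * (1 - v \<bullet> w) - p * k' - \<rho> / a * k * a')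
     + ((1 + N \<bullet> v) * ((B \<bullet> B) * (1 - v \<bullet> w) + (v \<bullet> B) * (w \<bullet> B)) - (v \<bullet> B) * (N \<bullet> B)
      + (N \<bullet> B) * ((1 - v \<bullet> v) * (w \<bullet> B) + (v \<bullet> B) * (v \<bullet> w)) - (1 + N \<bullet> w) * mag_pressure v B
      - ((1 - w \<bullet> w) *\<^sub>R b + (w \<bullet> b) *\<^sub>R w) \<bullet> ((1 + N \<bullet> v) *\<^sub>R B - (N \<bullet> B) *\<^sub>R v))"
    unfolding ndotF_eq[OF prim U v U[unfolded conserved_eq[OF v]]]
    unfolding U conserved_eq[OF v] nstar_def N_def[symmetric] k_def k'_def a_def[symmetric] a'_def[symmetric]
    unfolding a(2)[symmetric]
    unfolding add_Pair inner_Pair Z_def[symmetric] D_def[symmetric] real_scaleR_def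
      inner_diff_left inner_add_left inner_minus_right inner_add_right inner_diff_right
      inner_scaleR_left inner_scaleR_right inner_real_def
      inner_commute[of B w] inner_commute[of B b] inner_commute[of v b] inner_commute[of w v] by algebra
  then show ?thesis using gas magnetic_flux_bound[OF N v w, of B b]
    unfolding mB ndotB_eq N_def[symmetric] by (simp add: distrib_right)
qed

text \<open>The root of rho H in \<open>sigma\<close> originates here. The pairing T of the source
  with \<open>nstar w b\<close>, corrected by \<open>w \<bullet> b\<close>, satisfies P + e T >= 0
  for both e = r and e = -r with r^2 = rho H, because the gas surplus rho H |w - v|^2 / 2 is then
  exactly the loss in \<open>magnetic_source_bound\<close>. Hence |T| is at most P / r.\<close>

lemma source_dual_bound:
  assumes U: "U \<in> admissible H" and "eos H" and w: "norm w < 1"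
  shows "c * (source H U \<bullet> nstar w b + w \<bullet> b)
    \<ge> - (\<bar>c\<bar> / sqrt (density H U * enthalpy H U)) * (U \<bullet> nstar w b + mag_pressure w b)"
proof -
  obtain \<rho> v B p where prim: "prim_of H U = (\<rho>, v, B, p)" and q: "\<rho> > 0" "p > 0" and v: "norm v < 1"
    and U: "U = conserved H (\<rho>, v, B, p)" and h: "H p \<rho> > 1" "2 * H p \<rho> * (p / \<rho>) \<le> (H p \<rho>)^2 - 1"
    using admissible_cases[OF assms(1,2)] by metis
  define a a' where "a = sqrt (1 - v \<bullet> v)" and "a' = sqrt (1 - w \<bullet> w)"
  have a: "a > 0" "a^2 = 1 - v \<bullet> v" "a'^2 = 1 - w \<bullet> w"
    unfolding a_def a'_def using inner_self_less_one[OF v] inner_self_less_one[OF w] by auto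
  have gap: "2 * (1 - v \<bullet> w) - a^2 - a'^2 = (w - v) \<bullet> (w - v)"
    unfolding a quadratic_gap ..
  have H: "H p \<rho> > 0" "2 * H p \<rho> * (p / \<rho>) \<le> (H p \<rho>)^2 - 1"
    using h by auto
  have mB: "mag U = B" unfolding U conserved_eq[OF v] by (simp add: mag_def)
  define r where "r = sqrt (\<rho> * H p \<rho>)"
  have r: "r > 0" "r^2 = \<rho> * H p \<rho>" using H q by (auto simp: r_def)
  define P where "P = U \<bullet> nstar w b + mag_pressure w b"
  define T where "T = (v \<bullet> B) * (1 - v \<bullet> w) - (1 - v \<bullet> v) * (w \<bullet> B) + (w \<bullet> b) * (1 - v \<bullet> w) - (1 - w \<bullet> w) * (v \<bullet> b)"
  have "2 * (H p \<rho> * (1 - v \<bullet> w) - p / \<rho> * a^2 - a * a') \<ge> H p \<rho> * a^2 * ((w - v) \<bullet> (w - v))"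
    using gas_source_bound[of "H p \<rho>" "p / \<rho>" a a' "1 - v \<bullet> w", unfolded gap, OF H] a(2) gap
      inner_ge_zero[of "w - v"] inner_ge_zero[of v] by linarith
  then have *: "\<rho> / a^2 * (2 * (H p \<rho> * (1 - v \<bullet> w) - p / \<rho> * a^2 - a * a'))
      \<ge> \<rho> / a^2 * (H p \<rho> * a^2 * ((w - v) \<bullet> (w - v)))"
    using q(1) a(1) by (intro mult_left_mono) auto
  have gas: "\<rho> * H p \<rho> / a^2 * (1 - v \<bullet> w) - p - \<rho> / a * a' \<ge> r^2 * ((w - v) \<bullet> (w - v)) / 2"
  proof -
    define X where "X = H p \<rho> * (1 - v \<bullet> w) - p / \<rho> * a^2 - a * a'"
    have 1: "\<rho> / a^2 * (H p \<rho> * a^2 * ((w - v) \<bullet> (w - v))) = r^2 * ((w - v) \<bullet> (w - v))"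
      using a(1) r(2) by simp
    have 2: "\<rho> * H p \<rho> / a^2 * (1 - v \<bullet> w) - p - \<rho> / a * a' = \<rho> / a^2 * X"
      using gas_scaled[OF q(1) a(1), of "H p \<rho>" 1 "1 - v \<bullet> w" p 1 a'] unfolding X_def by simp
    have half: "y / 2 \<le> c * z" if "y \<le> c * (2 * z)" for y z c :: real using that by simp
    show ?thesis unfolding 2 by (rule half[OF *[folded X_def, unfolded 1]])
  qed
  have bound: "P + e * T \<ge> 0" if "e^2 = r^2" for e
    using gas magnetic_source_bound[OF w, where B = B and v = v and b = b and e = e, folded T_def]
    unfolding P_def U energy_decomposition[OF v] a_def[symmetric] a'_def[symmetric] unfolding a(2)[symmetric] that by linarith
  have "\<bar>T\<bar> * r \<le> P" using bound[of r] bound[of "- r"] r(1) by (auto simp: abs_if mult_ac)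
  then have TP: "\<bar>T\<bar> \<le> P / r" using r(1) by (simp add: pos_le_divide_eq)
  have "source H U \<bullet> nstar w b + w \<bullet> b = T"
    unfolding source_def Let_def velocity_def prim prod.case mB nstar_def T_def power2_norm_eq_inner
    unfolding add_Pair inner_Pair inner_diff_left inner_add_left inner_minus_right inner_add_right inner_diff_right
      inner_scaleR_left inner_scaleR_right inner_real_def
      inner_commute[of B w] inner_commute[of B b] inner_commute[of v w] by algebra
  moreover have "c * T \<ge> - (\<bar>c\<bar> * (P / r))"
    using mult_left_mono[OF TP, of "\<bar>c\<bar>"] abs_mult[of c T] by linarith
  ultimately show ?thesis
    unfolding density_def enthalpy_def prim prod.case r_def[symmetric] P_def[symmetric] by simp
qed

section \<open>Recovery of the primitive variables\<close>

lemma eos_antimono_density: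
  assumes "eos H" "p > 0" "0 < r" "r \<le> \<rho>"
  shows "H p \<rho> \<le> H p r"
proof (cases "r = \<rho>")
  case False
  have "\<exists>y. DERIV (\<lambda>\<rho>'. H p \<rho>') x :> y \<and> y < 0" if "x > 0" for x
  proof -
    have d: "(\<lambda>(p, \<rho>). H p \<rho>) differentiable (at (p, x))"
      and "deriv (\<lambda>\<rho>'. H p \<rho>') x < 0" using assms(1,2) that unfolding eos_def by blast+
    from d obtain F where F: "((\<lambda>(p, \<rho>). H p \<rho>) has_derivative F) (at (p, x))"
      unfolding differentiable_def by blast
    have "((\<lambda>(p, \<rho>). H p \<rho>) \<circ> (\<lambda>\<rho>'. (p, \<rho>')) has_derivative (F \<circ> (\<lambda>y. (0, y)))) (at x)"
      by (rule diff_chain_at[where f = "\<lambda>\<rho>'. (p, \<rho>')", OF _ F]) (auto intro!: derivative_eq_intros)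
    then have "(\<lambda>\<rho>'. H p \<rho>') differentiable (at x)" by (auto simp: o_def intro: differentiableI)
    then have "DERIV (\<lambda>\<rho>'. H p \<rho>') x :> deriv (\<lambda>\<rho>'. H p \<rho>') x"
      by (simp add: DERIV_deriv_iff_real_differentiable)
    with \<open>deriv (\<lambda>\<rho>'. H p \<rho>') x < 0\<close> show ?thesis by blast
  qed
  then have "\<exists>y. DERIV (\<lambda>\<rho>'. H p \<rho>') x :> y \<and> y < 0" if "r \<le> x" for x
    using that assms(3) by simp
  then have "H p \<rho> < H p r" using False assms(4) DERIV_neg_imp_decreasing[of r \<rho> "H p"] by simp
  then show ?thesis by simp
qed simp

lemma eos_continuous:
  assumes "eos H"
  shows "continuous_on ({0<..} \<times> {0<..}) (\<lambda>x. H (fst x) (snd x))"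
proof (intro continuous_at_imp_continuous_on ballI)
  fix x :: "real \<times> real" assume "x \<in> {0<..} \<times> {0<..}"
  then have "(\<lambda>(p, \<rho>). H p \<rho>) differentiable (at (fst x, snd x))" using assms unfolding eos_def by auto
  then show "isCont (\<lambda>x. H (fst x) (snd x)) x"
    using differentiable_imp_continuous_within by (fastforce simp: case_prod_unfold)
qed

text \<open>The vectors v and v' are the resolvents at Z and Z' of the positive semidefinite map
  that sends x to \<open>(B \<bullet> B) *\<^sub>R x - (x \<bullet> B) *\<^sub>R B\<close>, applied
  to one common right-hand side. Resolvents of such a map shrink as Z grows.\<close>

lemma resolvent_norm_antimono:
  fixes v v' B :: "'a::real_inner"
  assumes "0 < Z" "Z \<le> Z'"
    and "(Z + B \<bullet> B) *\<^sub>R v - (v \<bullet> B) *\<^sub>R B = (Z' + B \<bullet> B) *\<^sub>R v' - (v' \<bullet> B) *\<^sub>R B"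
  shows "norm v' \<le> norm v"
proof (rule ccontr)
  assume n: "\<not> norm v' \<le> norm v"
  let ?d = "v - v'"
  have "Z' *\<^sub>R v' - Z *\<^sub>R v = (B \<bullet> B) *\<^sub>R ?d - (?d \<bullet> B) *\<^sub>R B"
    using assms(3) by (simp add: algebra_simps inner_diff_left)
  then have "?d \<bullet> (Z' *\<^sub>R v' - Z *\<^sub>R v) = (B \<bullet> B) * (?d \<bullet> ?d) - (?d \<bullet> B)^2"
    by (simp add: inner_diff_right power2_eq_square)
  also have "\<dots> \<ge> 0" using Cauchy_Schwarz_ineq[of ?d B] by (simp add: mult.commute)
  finally have "(Z + Z') * (v \<bullet> v') \<ge> Z' * (v' \<bullet> v') + Z * (v \<bullet> v)"
    by (simp add: inner_diff_left inner_diff_right inner_commute algebra_simps)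
  moreover have "(Z + Z') * (v \<bullet> v') \<le> (Z + Z') * (norm v * norm v')"
    using assms norm_cauchy_schwarz by (intro mult_left_mono) auto
  ultimately have "(Z + Z') * (norm v * norm v') \<ge> Z' * (norm v')^2 + Z * (norm v)^2"
    by (simp add: power2_norm_eq_inner)
  then have "(Z' * norm v' - Z * norm v) * (norm v' - norm v) \<le> 0"
    by (simp add: algebra_simps power2_eq_square)
  moreover have "Z * norm v < Z' * norm v'"
    using n assms by (intro le_less_trans[OF mult_right_mono mult_strict_left_mono]) auto
  ultimately show False using n by (simp add: mult_le_0_iff)
qed

lemma mag_pressure_le:
  assumes "norm v < 1"
  shows "mag_pressure v B \<le> (B \<bullet> B) / 2"
  using Cauchy_Schwarz_ineq[of v B] by (simp add: mag_pressure_def algebra_simps)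

lemma inner_nstar_self: "B \<bullet> ((1 - v \<bullet> v) *\<^sub>R B + (v \<bullet> B) *\<^sub>R v) = 2 * mag_pressure v B"
  by (simp add: mag_pressure_def inner_add_right inner_commute[of B v] power2_eq_square)

text \<open>The primitive variables are sought along the curve parametrised by \<open>Z = \<rho> H W\<^sup>2\<close>, on which
  the conserved variables are already matched and only the equation of state is open.  The curve starts at the
  cold state (\<open>H = 1\<close>), whose pressure would be negative, and the intermediate value theorem, applied beyond the last zero of the
  pressure, supplies the point where the equation of state holds.\<close>

lemma admissibleI:
  fixes H :: "real \<Rightarrow> real \<Rightarrow> real"
  assumes eos: "eos H"
    and cold: "\<And>\<rho>. \<rho> > 0 \<Longrightarrow> ((\<lambda>p. internal_energy H p \<rho>) \<longlongrightarrow> 0) (at_right 0)"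
    and D: "D > 0"
    and pos: "\<And>w. norm w < 1 \<Longrightarrow> (D, m, B, E) \<bullet> nstar w B + mag_pressure w B > 0"
  shows "(D, m, B, E) \<in> admissible H"
proof -
  define \<beta> where "\<beta> = B \<bullet> B"
  have \<beta>: "\<beta> \<ge> 0" by (simp add: \<beta>_def)
  \<comment> \<open>Solves the momentum equation for given Z: its inner product with B gives
    \<open>v \<bullet> B = (m \<bullet> B) / Z\<close>, and then v can be isolated.\<close>
  define v where "v Z = (1 / (Z + \<beta>)) *\<^sub>R (m + ((m \<bullet> B) / Z) *\<^sub>R B)" for Z
  have vB: "v Z \<bullet> B = (m \<bullet> B) / Z" if "Z > 0" for Z
  proof -
    have "Z + \<beta> > 0" using that \<beta> by simp
    then show ?thesis using that
      by (simp add: v_def inner_add_left \<beta>_def[symmetric] divide_simps) (simp add: algebra_simps)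
  qed
  have m: "(Z + B \<bullet> B) *\<^sub>R v Z - (v Z \<bullet> B) *\<^sub>R B = m" if "Z > 0" for Z
    unfolding vB[OF that] using that \<beta> by (simp add: v_def \<beta>_def[symmetric])
  have mv: "m \<bullet> v Z = (Z + \<beta>) * (v Z \<bullet> v Z) - (v Z \<bullet> B)^2" if "Z > 0" for Z
    by (subst m[OF that, symmetric]) (simp add: inner_diff_left \<beta>_def inner_commute[of B "v Z"] power2_eq_square)
  have v_le: "norm (v Z) \<le> norm m / Z" if "Z > 0" for Z
  proof (cases "v Z = 0")
    case False
    have "Z * (norm (v Z))^2 \<le> m \<bullet> v Z"
      using Cauchy_Schwarz_ineq[of "v Z" B] mv[OF that] by (simp add: power2_norm_eq_inner \<beta>_def algebra_simps)
    also have "\<dots> \<le> norm m * norm (v Z)" by (rule norm_cauchy_schwarz)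
    finally have "Z * norm (v Z) \<le> norm m" using False by (simp add: power2_eq_square)
    then show ?thesis using that by (simp add: pos_le_divide_eq mult.commute)
  qed (use that in simp)
  have v_anti: "norm (v Z') \<le> norm (v Z)" if "0 < Z" "Z \<le> Z'" for Z Z'
    using that m by (intro resolvent_norm_antimono[of Z Z' B]) auto
  have v_cont: "continuous_on {0<..} v"
    unfolding v_def using \<beta> by (intro continuous_intros) auto

  \<comment> \<open>The cold state has H = 1, that is Z = D W, or
    \<open>Z^2 * (1 - v Z \<bullet> v Z) = D^2\<close>. The upper end of the search interval comes
    from |v Z| <= |m| / Z, which makes the left side at least Z^2 - |m|^2.\<close>
  have "\<exists>Z\<ge>D. Z \<le> sqrt (D^2 + (norm m)^2) \<and> Z^2 * (1 - v Z \<bullet> v Z) = D^2"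
  proof (rule IVT')
    let ?Y = "sqrt (D^2 + (norm m)^2)"
    show "D^2 * (1 - v D \<bullet> v D) \<le> D^2" 
      using mult_left_mono[of "1 - v D \<bullet> v D" 1 "D^2"] by simp
    show le: "D \<le> ?Y" by (rule real_le_rsqrt) simp
    then have Y: "?Y > 0" using D by linarith
    have "(norm (v ?Y))^2 \<le> (norm m / ?Y)^2" using v_le[OF Y] by (intro power_mono) auto
    also have "\<dots> = (norm m)^2 / ?Y^2" by (simp add: power_divide)
    finally have "?Y^2 * (v ?Y \<bullet> v ?Y) \<le> (norm m)^2"
      using Y by (subst (asm) pos_le_divide_eq) (auto simp: power2_norm_eq_inner mult.commute)
    then show "D^2 \<le> ?Y^2 * (1 - v ?Y \<bullet> v ?Y)" by (simp add: right_diff_distrib)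
    show "continuous_on {D..?Y} (\<lambda>Z. Z^2 * (1 - v Z \<bullet> v Z))"
      using D by (intro continuous_intros continuous_on_subset[OF v_cont]) auto
  qed
  then obtain Z0 where Z0: "Z0 \<ge> D" "Z0^2 * (1 - v Z0 \<bullet> v Z0) = D^2" by auto
  have Z0_pos: "Z0 > 0" using Z0 D by linarith
  define a where "a Z = sqrt (1 - v Z \<bullet> v Z)" for Z
  have "1 - v Z0 \<bullet> v Z0 > 0"
    using Z0(2) Z0_pos D by (metis zero_less_mult_pos zero_less_power)
  then have a0: "a Z0 > 0" by (simp add: a_def)
  have Z0a: "Z0 * a Z0 = D" unfolding a_def
    using Z0 Z0_pos D by (metis real_sqrt_mult real_sqrt_abs abs_of_pos)
  have a_mono: "a Z0 \<le> a Z" if "Z \<ge> Z0" for Z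
    using v_anti[OF Z0_pos that] unfolding a_def by (simp add: norm_le)
  have a_pos: "a Z > 0" if "Z \<ge> Z0" for Z using a_mono[OF that] a0 by linarith
  have a_sq: "(a Z)^2 = 1 - v Z \<bullet> v Z" if "Z \<ge> Z0" for Z
    using a_pos[OF that] unfolding a_def by simp
  have v1: "norm (v Z) < 1" if "Z \<ge> Z0" for Z
    using a_pos[OF that] unfolding a_def by (simp add: norm_lt_square)
  have a_le: "a Z \<le> 1" for Z unfolding a_def by simp

  \<comment> \<open>The energy equation solved for the pressure; the mass equation, solved likewise,
    gives the density \<open>\<rho> Z\<close>.\<close>
  define P where "P Z = Z - E + \<beta> - mag_pressure (v Z) B" for Z
  define \<rho> where "\<rho> Z = D * a Z" for Z
  have \<rho>_pos: "\<rho> Z > 0" if "Z \<ge> Z0" for Z using a_pos[OF that] D by (simp add: \<rho>_def)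
  have v_cont': "continuous_on {Z0..} v" using Z0_pos by (intro continuous_on_subset[OF v_cont]) auto
  have a_cont: "continuous_on {Z0..} a" unfolding a_def using v_cont' by (intro continuous_intros)
  have P_cont: "continuous_on {Z0..} P"
    unfolding P_def mag_pressure_def using v_cont' by (intro continuous_intros) auto
  have \<rho>_cont: "continuous_on {Z0..} \<rho>" unfolding \<rho>_def using a_cont by (intro continuous_intros)
  have P_ge: "P Z \<ge> Z - E" if "Z \<ge> Z0" for Z
    using mag_pressure_le[OF v1[OF that], of B] inner_ge_zero[of B]
    unfolding P_def \<beta>_def by linarith

  \<comment> \<open>The dual condition at w = v Z0 and b = B is literally the positivity of - P
    Z0.\<close>
  have "P Z0 < 0"
  proof -
    let ?v = "v Z0"
    have "(D, m, B, E) \<bullet> nstar ?v B + mag_pressure ?v B = E - m \<bullet> ?v - D * a Z0 - mag_pressure ?v B"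
      using inner_nstar_self[of B ?v]
      by (simp add: nstar_def a_def inner_minus_right del: minus_add_distrib inner_add_right)
    moreover have "D * a Z0 = Z0 * (1 - ?v \<bullet> ?v)"
      using a_sq[of Z0] Z0a by (metis mult.assoc order_refl power2_eq_square)
    ultimately show ?thesis using pos[OF v1[of Z0]] mv[OF Z0_pos]
      by (simp add: P_def mag_pressure_def \<beta>_def algebra_simps)
  qed

  define S where "S = {Z \<in> {Z0..}. P Z \<le> 0}"
  have S: "S \<noteq> {}" "bdd_above S" "closed S"
  proof -
    show "S \<noteq> {}" using \<open>P Z0 < 0\<close> by (auto simp: S_def)
    show "bdd_above S" using P_ge by (intro bdd_aboveI[of _ E]) (force simp: S_def)
    have "S = {Z0..} \<inter> P -` {..0}" by (auto simp: S_def)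
    then show "closed S" using continuous_closed_preimage[OF P_cont closed_atLeast closed_atMost] by metis
  qed
  define Z1 where "Z1 = Sup S"
  have Z1S: "Z1 \<in> S" unfolding Z1_def using S by (intro closed_contains_Sup)
  then have Z1: "Z1 \<ge> Z0" "P Z1 \<le> 0" by (auto simp: S_def)
  have P_pos: "P Z > 0" if "Z > Z1" for Z
  proof -
    have "Z \<notin> S" using that cSup_upper[OF _ S(2), of Z] unfolding Z1_def[symmetric] by auto
    then show ?thesis using that Z1(1) by (auto simp: S_def)
  qed
  have P_lim: "(P \<longlongrightarrow> P Z1) (at_right Z1)"
    using P_cont Z1(1) unfolding continuous_on_def by (auto intro: tendsto_within_subset)
  have "P Z1 \<ge> 0"
    using P_pos by (intro tendsto_lowerbound[OF P_lim]) (auto simp: eventually_at_filter less_imp_le)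
  with Z1 have PZ1: "P Z1 = 0" by simp
  with \<open>P Z0 < 0\<close> Z1(1) have Z1_gt: "Z1 > Z0" by (metis less_le order_less_irrefl)

  \<comment> \<open>Since Z = rho H W^2 and rho = D a, the curve demands the enthalpy Z a / D. This
    equals 1 at Z0 and exceeds 1 at Z1; c is the midpoint between 1, the cold limit of H, and the
    demand at Z1.\<close>
  define c where "c = (1 + Z1 * a Z1 / D) / 2"
  have "D < Z1 * a Z1"
    using Z1_gt Z0_pos a0 a_mono[OF Z1(1)] unfolding Z0a[symmetric] by (intro mult_less_le_imp_less) auto
  then have c: "c > 1" "Z1 * a Z1 / D > c" using D by (auto simp: c_def field_simps)
  have "((\<lambda>Z. Z * a Z / D) \<longlongrightarrow> Z1 * a Z1 / D) (at_right Z1)"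
  proof -
    have "(a \<longlongrightarrow> a Z1) (at_right Z1)"
      using a_cont Z1(1) unfolding continuous_on_def by (auto intro: tendsto_within_subset)
    then show ?thesis using D by (intro tendsto_intros) auto
  qed
  then have ev1: "eventually (\<lambda>Z. Z * a Z / D > c) (at_right Z1)" using c(2) by (rule order_tendstoD(1))
  \<comment> \<open>The cold limit is assumed separately for each density, whereas the density
    varies along the curve. The value r bounds it from below there, and H decreases with density, so
    the limit at the single density r controls H just past Z1.\<close>
  define r where "r = \<rho> Z0"
  have r: "r > 0" using \<rho>_pos[of Z0] by (simp add: r_def)
  have "((\<lambda>p. 1 + p / r + internal_energy H p r) \<longlongrightarrow> 1 + 0 / r + 0) (at_right 0)"
    using r by (intro tendsto_intros cold) auto
  then have H_lim: "((\<lambda>p. H p r) \<longlongrightarrow> 1) (at_right 0)" by (simp add: internal_energy_def)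
  have "filterlim P (at_right 0) (at_right Z1)"
  proof -
    have "P Z \<in> {0<..} \<and> P Z \<noteq> 0" if "Z > Z1" for Z using P_pos[OF that] by simp
    then have "eventually (\<lambda>Z. P Z \<in> {0<..} \<and> P Z \<noteq> 0) (at_right Z1)"
      unfolding eventually_at_filter by (intro always_eventually) simp
    then show ?thesis using P_lim by (simp add: filterlim_at PZ1)
  qed
  from filterlim_compose[OF H_lim this]
  have ev2: "eventually (\<lambda>Z. H (P Z) r < c) (at_right Z1)" using c(1) by (rule order_tendstoD(2))
  have "eventually (\<lambda>Z. Z > Z1 \<and> Z * a Z / D > c \<and> H (P Z) r < c) (at_right Z1)"
    using ev1 ev2 by (auto simp: eventually_at_filter elim: eventually_elim2)
  then obtain Z2 where Z2: "Z2 > Z1" "Z2 * a Z2 / D > c" "H (P Z2) r < c"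
    using eventually_happens trivial_limit_at_right_real by blast
  have "r \<le> \<rho> Z2" using a_mono[of Z2] Z1(1) Z2(1) D by (simp add: r_def \<rho>_def)
  then have f2: "H (P Z2) (\<rho> Z2) - Z2 * a Z2 / D \<le> 0"
    using eos_antimono_density[OF eos P_pos[OF Z2(1)] r, of "\<rho> Z2"] Z2 by linarith

  \<comment> \<open>From Z >= 2 E on, P Z >= Z / 2, so the demanded enthalpy is at most twice P /
    rho, while the equation of state gives H at least that much. The sign of the difference is thus
    reversed relative to Z2.\<close>
  define Z3 where "Z3 = max Z2 (2 * E)"
  have Z3: "Z3 > Z1" "Z3 \<ge> 2 * E" "Z3 \<ge> Z0" using Z2(1) Z1(1) by (auto simp: Z3_def)
  have "E > 0" using P_ge[OF Z1(1)] PZ1 Z1_gt Z0_pos by linarith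
  have f3: "H (P Z3) (\<rho> Z3) - Z3 * a Z3 / D \<ge> 0"
  proof -
    let ?x = "P Z3 / \<rho> Z3"
    have x: "?x > 0" using P_pos[OF Z3(1)] \<rho>_pos[OF Z3(3)] by simp
    have "?x \<le> sqrt (1 + ?x^2)" by (rule real_le_rsqrt) simp
    then have "2 * ?x \<le> H (P Z3) (\<rho> Z3)"
      using eos P_pos[OF Z3(1)] \<rho>_pos[OF Z3(3)] unfolding eos_def power_divide by (smt (verit))
    moreover have "Z3 * a Z3 / D \<le> 2 * ?x"
    proof -
      have "Z3 * a Z3 * a Z3 \<le> Z3 * 1 * 1"
        using a_le[of Z3] a_pos[OF Z3(3)] Z3(3) Z0_pos by (intro mult_mono) auto
      also have "\<dots> \<le> 2 * P Z3" using P_ge[OF Z3(3)] Z3(2) by linarith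
      finally show ?thesis using D a_pos[OF Z3(3)] by (simp add: \<rho>_def field_simps)
    qed
    ultimately show ?thesis by linarith
  qed
  have "\<exists>Z\<ge>Z2. Z \<le> Z3 \<and> H (P Z) (\<rho> Z) - Z * a Z / D = 0"
  proof (rule IVT'[where f = "\<lambda>Z. H (P Z) (\<rho> Z) - Z * a Z / D", OF f2 f3])
    have sub: "{Z2..Z3} \<subseteq> {Z0..}" using Z2(1) Z1(1) by auto
    have "continuous_on {Z2..Z3} (\<lambda>Z. (\<lambda>x. H (fst x) (snd x)) (P Z, \<rho> Z))"
      using Z2(1) P_pos \<rho>_pos sub
      by (intro continuous_on_compose2[OF eos_continuous[OF eos]] continuous_intros
          continuous_on_subset[OF P_cont] continuous_on_subset[OF \<rho>_cont]) (auto simp: subset_iff)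
    then show "continuous_on {Z2..Z3} (\<lambda>Z. H (P Z) (\<rho> Z) - Z * a Z / D)"
      using D sub by (intro continuous_intros continuous_on_subset[OF a_cont]) auto
  qed (simp add: Z3_def)
  then obtain Z where Z: "Z \<ge> Z2" and HZ: "H (P Z) (\<rho> Z) = Z * a Z / D" by auto
  have ZZ: "Z > Z1" "Z \<ge> Z0" "Z > 0" using Z Z2(1) Z1(1) Z0_pos by auto
  have "internal_energy H (P Z) (\<rho> Z) > 0"
  proof -
    have "P Z / \<rho> Z > 0" using P_pos[OF ZZ(1)] \<rho>_pos[OF ZZ(2)] by simp
    then have "H (P Z) (\<rho> Z) > 1 + P Z / \<rho> Z"
      using eos P_pos[OF ZZ(1)] \<rho>_pos[OF ZZ(2)] unfolding eos_def
      by (intro enthalpy_quadratic_bound(2)) (auto simp: power_divide)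
    then show ?thesis by (simp add: internal_energy_def)
  qed
  then have adm: "(\<rho> Z, v Z, B, P Z) \<in> admissible_prim H"
    using P_pos[OF ZZ(1)] \<rho>_pos[OF ZZ(2)] v1[OF ZZ(2)] by (simp add: admissible_prim_def)
  have "\<rho> Z * H (P Z) (\<rho> Z) / (1 - v Z \<bullet> v Z) = Z"
    unfolding HZ a_sq[OF ZZ(2), symmetric] using a_pos[OF ZZ(2)] D by (simp add: \<rho>_def power2_eq_square)
  moreover have "\<rho> Z / sqrt (1 - v Z \<bullet> v Z) = D"
    unfolding a_def[symmetric] using a_pos[OF ZZ(2)] by (simp add: \<rho>_def)
  ultimately have "conserved H (\<rho> Z, v Z, B, P Z) = (D, m, B, E)"
    unfolding conserved_eq[OF v1[OF ZZ(2)]] using m[OF ZZ(3)] by (simp add: P_def \<beta>_def)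
  then show ?thesis using adm unfolding admissible_def by (metis imageI)
qed

section \<open>The divergence theorem on polygonal cells\<close>

text \<open>The summands \<open>s i * g (c i)\<close> switched on after each crossing compensate the jumps of the
  cut-off antiderivative, so the fundamental theorem of calculus applies without ordering the crossings.\<close>

lemma slice_integral:
  fixes A :: "real set" and g g' :: "real \<Rightarrow> real" and c s :: "'i \<Rightarrow> real"
  assumes I: "finite I" "inj_on c I" and A: "bounded A"
    and g: "\<And>t. (g has_real_derivative g' t) (at t)"
    and off: "\<And>t. t \<notin> c ` I \<Longrightarrow> eventually (\<lambda>u. u \<in> A \<longleftrightarrow> t \<in> A) (nhds t)"
    and cross: "\<And>i. i \<in> I \<Longrightarrow> s i = 1 \<and> eventually (\<lambda>u. u \<in> A \<longleftrightarrow> u \<le> c i) (nhds (c i))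
      \<or> s i = - 1 \<and> eventually (\<lambda>u. u \<in> A \<longleftrightarrow> u \<ge> c i) (nhds (c i))"
  shows "((\<lambda>t. indicator A t * g' t) has_integral (\<Sum>i\<in>I. s i * g (c i))) UNIV"
proof -
  \<comment> \<open>At a right end (s i = 1) the point c i still belongs to A, so the compensation
    starts strictly after it; at a left end it starts at c i, together with A. This choice makes F
    continuous.\<close>
  define J :: "'i \<Rightarrow> real \<Rightarrow> real" where "J i t = (if s i = 1 then of_bool (t > c i) else of_bool (t \<ge> c i))" for i t
  define F where "F t = indicator A t * g t + (\<Sum>i\<in>I. s i * g (c i) * J i t)" for t
  have J_ev: "eventually (\<lambda>u. \<forall>i\<in>I. c i \<noteq> t \<longrightarrow> J i u = J i t) (nhds t)" for t
  proof (intro eventually_ball_finite ballI I(1))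
    fix i
    have "eventually (\<lambda>u. c i \<noteq> t \<longrightarrow> (u > c i \<longleftrightarrow> t > c i) \<and> (u \<ge> c i \<longleftrightarrow> t \<ge> c i)) (nhds t)"
    proof (cases "c i" t rule: linorder_cases)
      case less
      have "eventually (\<lambda>u. u \<in> {c i<..}) (nhds t)" using less by (intro eventually_nhds_in_open) auto
      then show ?thesis by eventually_elim (use less in auto)
    next
      case greater
      have "eventually (\<lambda>u. u \<in> {..<c i}) (nhds t)" using greater by (intro eventually_nhds_in_open) auto
      then show ?thesis by eventually_elim (use greater in auto)
    qed simp
    then show "eventually (\<lambda>u. c i \<noteq> t \<longrightarrow> J i u = J i t) (nhds t)"
      by eventually_elim (auto simp: J_def)
  qed
  have F_off: "eventually (\<lambda>u. F u = indicator A t * g u + (\<Sum>i\<in>I. s i * g (c i) * J i t)) (nhds t)"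
    if t: "t \<notin> c ` I" for t
    using J_ev[of t] off[OF t]
  proof eventually_elim
    case (elim u)
    then have "(\<Sum>i\<in>I. s i * g (c i) * J i u) = (\<Sum>i\<in>I. s i * g (c i) * J i t)"
      using t by (intro sum.cong) auto
    with elim show ?case by (simp add: F_def indicator_def)
  qed
  have F_deriv: "(F has_real_derivative indicator A t * g' t) (at t)" if "t \<notin> c ` I" for t
  proof -
    have "((\<lambda>u. indicator A t * g u + (\<Sum>i\<in>I. s i * g (c i) * J i t)) has_real_derivative indicator A t * g' t) (at t)"
      by (auto intro!: derivative_eq_intros g)
    then show ?thesis using DERIV_cong_ev[OF refl F_off[OF that] refl] by blast
  qed
  have F_cont: "isCont F t" for t
  proof (cases "t \<in> c ` I")
    case False
    then show ?thesis using F_deriv DERIV_isCont by blast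
  next
    case True
    then obtain i where i: "i \<in> I" "t = c i" by auto
    have g_cont: "isCont g x" for x using g DERIV_isCont by blast
    define S where "S = (\<Sum>j\<in>I - {i}. s j * g (c j) * J j t)"
    have F_S: "eventually (\<lambda>u. F u = indicator A u * g u + s i * g (c i) * J i u + S) (nhds t)"
      using J_ev[of t]
    proof eventually_elim
      case (elim u)
      have "(\<Sum>j\<in>I - {i}. s j * g (c j) * J j u) = S"
        unfolding S_def using elim i I(2) by (intro sum.cong) (auto dest: inj_onD)
      then show ?case using I(1) i(1) by (simp add: F_def sum.remove)
    qed
    from cross[OF i(1)] show ?thesis
    proof (elim disjE conjE)
      assume s: "s i = 1" and "eventually (\<lambda>u. u \<in> A \<longleftrightarrow> u \<le> c i) (nhds (c i))"
      \<comment> \<open>Past a right end the constant that is switched on equals the value lost with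
        A, so F is g stopped at t, up to a constant.\<close>
      from this(2) F_S have "eventually (\<lambda>u. F u = g (min u t) + S) (nhds t)"
        unfolding i(2) by eventually_elim (auto simp: s J_def indicator_def min_def)
      moreover have "isCont (\<lambda>u. g (min u t) + S) t"
        by (intro isCont_add isCont_o2[OF _ g_cont] continuous_min continuous_ident continuous_const)
      ultimately show ?thesis by (rule isCont_cong[THEN iffD2])
    next
      assume s: "s i = - 1" and "eventually (\<lambda>u. u \<in> A \<longleftrightarrow> u \<ge> c i) (nhds (c i))"
      from this(2) F_S have "eventually (\<lambda>u. F u = g (max u t) - g t + S) (nhds t)"
        unfolding i(2) by eventually_elim (auto simp: s J_def indicator_def max_def)
      moreover have "isCont (\<lambda>u. g (max u t) - g t + S) t"
        by (intro isCont_add isCont_diff isCont_o2[OF _ g_cont] continuous_max continuous_ident continuous_const)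
      ultimately show ?thesis by (rule isCont_cong[THEN iffD2])
    qed
  qed
  have "bounded (A \<union> c ` I)" using A I(1) by (simp add: finite_imp_bounded)
  then obtain M where M: "\<And>t. t \<in> A \<union> c ` I \<Longrightarrow> norm t \<le> M" unfolding bounded_iff by blast
  define b where "b = \<bar>M\<bar> + 1"
  have b: "- b < t \<and> t < b" if "t \<in> A \<union> c ` I" for t using M[OF that] unfolding b_def by auto
  have "b > 0" by (simp add: b_def)
  have "((\<lambda>t. indicator A t * g' t) has_integral F b - F (- b)) {- b..b}"
  proof (rule fundamental_theorem_of_calculus_interior_strong[of "c ` I"])
    show "continuous_on {- b..b} F" using F_cont by (intro continuous_at_imp_continuous_on) auto
    show "(F has_vector_derivative indicator A t * g' t) (at t)" if "t \<in> {- b<..<b} - c ` I" for t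
      using F_deriv[of t] that by (simp add: has_real_derivative_iff_has_vector_derivative)
  qed (use I(1) \<open>b > 0\<close> in auto)
  moreover have "F (- b) = 0"
  proof -
    have "- b \<notin> A" using b[of "- b"] by auto
    moreover have "J i (- b) = 0" if "i \<in> I" for i using b[of "c i"] that by (auto simp: J_def)
    ultimately show ?thesis by (simp add: F_def)
  qed
  moreover have "F b = (\<Sum>i\<in>I. s i * g (c i))"
  proof -
    have "b \<notin> A" using b[of b] by auto
    moreover have "J i b = 1" if "i \<in> I" for i using b[of "c i"] that by (auto simp: J_def)
    ultimately show ?thesis by (simp add: F_def)
  qed
  ultimately have "((\<lambda>t. indicator A t * g' t) has_integral (\<Sum>i\<in>I. s i * g (c i))) {- b..b}" by simp
  moreover have "indicator A t * g' t = 0" if "t \<notin> {- b..b}" for t using b[of t] that by (auto simp: indicator_def)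
  ultimately show ?thesis by (rule has_integral_on_superset) auto
qed

text \<open>The transverse coordinate y comes first, so that Fubini makes the coordinate x in
  direction i, along which the derivative is taken, the inner variable.\<close>

definition plane_pt :: "2 \<Rightarrow> 2 \<Rightarrow> real \<times> real \<Rightarrow> real^2" where
  "plane_pt i j = (\<lambda>(y, x). x *\<^sub>R axis i 1 + y *\<^sub>R axis j 1)"

lemma UNIV_two:
  assumes "i \<noteq> (j::2)"
  shows "UNIV = {i, j}"
proof -
  have "k = i \<or> k = j" for k using assms exhaust_2[of i] exhaust_2[of j] exhaust_2[of k] by auto
  then show ?thesis by auto
qed

lemma forall_two: "i \<noteq> (j::2) \<Longrightarrow> (\<forall>k. P k) \<longleftrightarrow> P i \<and> P j"
  using UNIV_two[of i j] by (metis UNIV_I insertE singletonD)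

lemma plane_pt_nth:
  assumes "i \<noteq> j"
  shows "plane_pt i j (y, x) $ i = x" "plane_pt i j (y, x) $ j = y"
  using assms by (simp_all add: plane_pt_def axis_def)

lemma plane_pt_eq_iff:
  assumes "i \<noteq> j"
  shows "plane_pt i j (y, x) = z \<longleftrightarrow> x = z $ i \<and> y = z $ j"
  by (auto simp: vec_eq_iff forall_two[OF assms] plane_pt_nth[OF assms])

lemma continuous_plane_pt: "continuous_on UNIV (plane_pt i j)"
  unfolding plane_pt_def case_prod_unfold by (intro continuous_intros)

text \<open>Lebesgue measure is determined by its values on boxes, and boxes pull back to products
  of intervals. This transfers Fubini from pairs to \<open>real^2\<close> for either order of the
  coordinates.\<close>

lemma lborel_plane_pt:
  assumes ij: "i \<noteq> j"
  shows "lborel = distr (lborel \<Otimes>\<^sub>M lborel) borel (plane_pt i j)"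
proof (rule lborel_eqI)
  have [measurable]: "plane_pt i j \<in> borel_measurable (lborel \<Otimes>\<^sub>M lborel)"
    using borel_measurable_continuous_onI[OF continuous_plane_pt] by (simp add: lborel_prod)
  fix l u :: "real^2" assume le: "\<And>b. b \<in> Basis \<Longrightarrow> l \<bullet> b \<le> u \<bullet> b"
  have le': "l $ k \<le> u $ k" for k using le[of "axis k 1"] by (simp add: inner_axis)
  have "plane_pt i j -` box l u = {l $ j<..<u $ j} \<times> {l $ i<..<u $ i}"
    by (auto simp: mem_box_cart forall_two[OF ij] plane_pt_nth[OF ij])
  then have "emeasure (distr (lborel \<Otimes>\<^sub>M lborel) borel (plane_pt i j)) (box l u)
      = emeasure (lborel \<Otimes>\<^sub>M lborel) ({l $ j<..<u $ j} \<times> {l $ i<..<u $ i})"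
    by (subst emeasure_distr) (auto simp: space_pair_measure)
  also have "\<dots> = ennreal (u $ j - l $ j) * ennreal (u $ i - l $ i)"
    using le' by (subst lborel.emeasure_pair_measure_Times) auto
  also have "\<dots> = ennreal ((u $ j - l $ j) * (u $ i - l $ i))"
    using le' by (subst ennreal_mult) auto
  also have "(u $ j - l $ j) * (u $ i - l $ i) = (\<Prod>b\<in>Basis. (u - l) \<bullet> b)"
  proof -
    have "(\<Prod>b\<in>Basis. (u - l) \<bullet> b) = (\<Prod>k\<in>UNIV. (u - l) \<bullet> axis k 1)"
      unfolding Basis_vec_def by (subst prod.UNION_disjoint) (auto simp: axis_eq_axis)
    then show ?thesis using ij by (simp add: UNIV_two[OF ij] inner_axis)
  qed
  finally show "emeasure (distr (lborel \<Otimes>\<^sub>M lborel) borel (plane_pt i j)) (box l u)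
    = (\<Prod>b\<in>Basis. (u - l) \<bullet> b)" .
qed simp

section \<open>Edges, normals and the crossing of an edge\<close>

lemma polygonal_cellD:
  assumes "polygonal_cell K es"
  shows "compact K" "interior K \<noteq> {}" "finite es" "\<And>e. e \<in> es \<Longrightarrow> fst e \<noteq> snd e"
    "frontier K = (\<Union>e\<in>es. closed_segment (fst e) (snd e))"
    "\<And>e e'. e \<in> es \<Longrightarrow> e' \<in> es \<Longrightarrow> e \<noteq> e' \<Longrightarrow>
        open_segment (fst e) (snd e) \<inter> closed_segment (fst e') (snd e') = {}"
    "\<And>e x. e \<in> es \<Longrightarrow> x \<in> open_segment (fst e) (snd e) \<Longrightarrow> \<exists>\<delta>>0. \<forall>t. 0 < t \<and> t < \<delta> \<longrightarrow>
        x + t *\<^sub>R edge_normal e \<notin> K \<and> x - t *\<^sub>R edge_normal e \<in> K"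
  using assms unfolding polygonal_cell_def case_prod_beta' prod.collapse by blast+

lemma edge_normal_nth:
  assumes "fst e \<noteq> snd e" "i \<noteq> j"
  shows "edge_length e * edge_normal e $ i = (if i = 1 then 1 else - 1) * ((snd e - fst e) $ j)"
proof -
  obtain a b where e: "e = (a, b)" by (cases e)
  have "i = 1 \<and> j = 2 \<or> i = 2 \<and> j = 1"
    using exhaust_2[of i] exhaust_2[of j] assms(2) by auto
  then show ?thesis using assms(1) by (auto simp: e edge_length_def edge_normal_def)
qed

lemma edge_normal_inner_edge:
  "edge_normal e \<bullet> (snd e - fst e) = 0"
proof -
  have "vector [x $ 2, - (x $ 1)] \<bullet> x = 0" for x :: "real^2"
    by (simp add: inner_vec_def sum_2)
  from this[of "snd e - fst e"] show ?thesis
    by (simp add: edge_normal_def case_prod_beta' del: vector_minus_component)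
qed

lemma edge_normal_norm:
  assumes "fst e \<noteq> snd e"
  shows "norm (edge_normal e) = 1"
proof -
  have "norm (vector [x $ 2, - (x $ 1)] :: real^2) = norm x" for x :: "real^2"
    by (simp add: norm_eq_sqrt_inner inner_vec_def sum_2)
  from this[of "snd e - fst e"] show ?thesis using assms
    by (simp add: edge_normal_def case_prod_beta' dist_norm norm_minus_commute del: vector_minus_component)
qed

text \<open>Near an interior point of an edge, the frontier of the cell lies on the line of that edge, so each of the two half discs is
  either contained in the cell or disjoint from it.\<close>

lemma polygonal_cell_crossing:
  assumes K: "polygonal_cell K es" and e: "e \<in> es" and z: "z \<in> open_segment (fst e) (snd e)"
    and w: "edge_normal e \<bullet> w \<noteq> 0"
  shows "eventually (\<lambda>h. z + h *\<^sub>R w \<in> K \<longleftrightarrow> h * (edge_normal e \<bullet> w) \<le> 0) (nhds 0)"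
proof -
  define n where "n = edge_normal e"
  note D = polygonal_cellD[OF K]
  have n1: "n \<bullet> n = 1" using edge_normal_norm[OF D(4)[OF e]] by (simp add: n_def dot_square_norm)
  have K_closed: "closed K" using D(1) by (rule compact_imp_closed)
  obtain \<delta> where \<delta>: "\<delta> > 0" "\<And>t. 0 < t \<Longrightarrow> t < \<delta> \<Longrightarrow> z + t *\<^sub>R n \<notin> K \<and> z - t *\<^sub>R n \<in> K"
    using D(7)[OF e z] unfolding n_def by blast
  define T where "T = (\<Union>e'\<in>es - {e}. closed_segment (fst e') (snd e'))"
  have "closed T" unfolding T_def using D(3) by (intro closed_UN) auto
  moreover have "z \<notin> T" using D(6)[OF e] z by (auto simp: T_def)
  ultimately obtain \<epsilon> where \<epsilon>: "\<epsilon> > 0" "ball z \<epsilon> \<inter> T = {}"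
    by (metis ComplI disjoint_eq_subset_Compl openE open_Compl)
  have line: "n \<bullet> y = n \<bullet> z" if "y \<in> ball z \<epsilon>" "y \<in> frontier K" for y
  proof -
    have "y \<in> closed_segment (fst e) (snd e)" using that \<epsilon>(2) unfolding D(5) T_def by blast
    moreover have "z \<in> closed_segment (fst e) (snd e)" using z by (simp add: open_segment_def)
    moreover have "n \<bullet> x = n \<bullet> fst e" if "x \<in> closed_segment (fst e) (snd e)" for x
    proof -
      from that obtain u where "x = fst e + u *\<^sub>R (snd e - fst e)" by (auto simp: in_segment algebra_simps)
      then show ?thesis using edge_normal_inner_edge[of e] by (simp add: n_def inner_add_right)
    qed
    ultimately show ?thesis by metis
  qed
  obtain t where t: "0 < t" "t < \<delta>" "t < \<epsilon>" using \<delta>(1) \<epsilon>(1) by (metis field_lbound_gt_zero)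
  have tn: "z + t *\<^sub>R n \<in> ball z \<epsilon>" "z - t *\<^sub>R n \<in> ball z \<epsilon>"
    using t n1 by (auto simp: dist_norm norm_eq_sqrt_inner)
  have out: "y \<notin> K" if "y \<in> ball z \<epsilon>" "n \<bullet> y > n \<bullet> z" for y
  proof
    assume "y \<in> K"
    let ?H = "ball z \<epsilon> \<inter> {y. n \<bullet> y > n \<bullet> z}"
    \<comment> \<open>A connected set that meets both K and its complement meets the frontier, but
      near z the frontier stays on the line that bounds this half disc.\<close>
    have "connected ?H" by (intro convex_connected convex_Int convex_ball convex_halfspace_gt)
    moreover have "z + t *\<^sub>R n \<in> ?H - K" using tn t \<delta>(2)[of t] n1 by (simp add: inner_add_right)
    moreover have "y \<in> ?H \<inter> K" using that \<open>y \<in> K\<close> by simp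
    ultimately have "?H \<inter> frontier K \<noteq> {}" using connected_Int_frontier[of ?H K] by blast
    then show False using line by force
  qed
  have inside: "y \<in> K" if "y \<in> ball z \<epsilon>" "n \<bullet> y < n \<bullet> z" for y
  proof (rule ccontr)
    assume "y \<notin> K"
    let ?H = "ball z \<epsilon> \<inter> {y. n \<bullet> y < n \<bullet> z}"
    have "connected ?H" by (intro convex_connected convex_Int convex_ball convex_halfspace_lt)
    moreover have "z - t *\<^sub>R n \<in> ?H \<inter> K" using tn t \<delta>(2)[of t] n1 by (simp add: inner_diff_right)
    moreover have "y \<in> ?H - K" using that \<open>y \<notin> K\<close> by simp
    ultimately have "?H \<inter> frontier K \<noteq> {}" using connected_Int_frontier[of ?H K] by blast
    then show False using line by force
  qed
  have "z \<in> frontier K" unfolding D(5) using e z by (auto simp: open_segment_def)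
  then have zK: "z \<in> K" using K_closed frontier_subset_closed by blast
  have "((\<lambda>h. z + h *\<^sub>R w) \<longlongrightarrow> z + 0 *\<^sub>R w) (nhds 0)" by (intro tendsto_intros filterlim_ident)
  then have "eventually (\<lambda>h. z + h *\<^sub>R w \<in> ball z \<epsilon>) (nhds 0)"
    using \<epsilon>(1) by (intro topological_tendstoD[where l = z]) auto
  then show ?thesis
  proof eventually_elim
    case (elim h)
    have "h * (n \<bullet> w) = n \<bullet> (z + h *\<^sub>R w) - n \<bullet> z" by (simp add: inner_add_right)
    moreover have "h = 0" if "h * (n \<bullet> w) = 0" using that w by (simp add: n_def)
    ultimately show ?case using out[OF elim] inside[OF elim] zK unfolding n_def[symmetric]
      by (cases "h * (n \<bullet> w)" "0 :: real" rule: linorder_cases) auto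
  qed
qed

definition edge_at :: "edge \<Rightarrow> real \<Rightarrow> real^2" where
  "edge_at e t = fst e + t *\<^sub>R (snd e - fst e)"

lemma edge_at_closed_segment: "y \<in> closed_segment (fst e) (snd e) \<longleftrightarrow> (\<exists>t\<in>{0..1}. y = edge_at e t)"
  by (auto simp: in_segment edge_at_def algebra_simps)

lemma edge_at_open_segment:
  "fst e \<noteq> snd e \<Longrightarrow> 0 < t \<Longrightarrow> t < 1 \<Longrightarrow> edge_at e t \<in> open_segment (fst e) (snd e)"
  by (auto simp: in_segment edge_at_def algebra_simps intro!: exI[of _ t])

text \<open>The parameter at which the line through the edge reaches j-coordinate y. For an edge
  parallel to the slice it is a division by zero with the default value 0, so every use excludes
  such edges.\<close>

definition height_param :: "2 \<Rightarrow> edge \<Rightarrow> real \<Rightarrow> real" where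
  "height_param j e y = (y - fst e $ j) / (snd e $ j - fst e $ j)"

text \<open>Avoiding the heights of the endpoints makes every meeting of the slice with the frontier
  a transversal crossing in the open part of exactly one edge. The sign of the normal component
  along the slice tells whether the slice leaves or enters the cell.\<close>

lemma polygonal_cell_slice_integral:
  fixes f f' :: "real^2 \<Rightarrow> real"
  assumes K: "polygonal_cell K es" and ij: "i \<noteq> j"
    and f: "\<And>x. ((\<lambda>t. f (x + t *\<^sub>R axis i 1)) has_real_derivative f' x) (at 0)"
    and y: "y \<notin> (\<lambda>p. p $ j) ` (fst ` es \<union> snd ` es)"
  shows "((\<lambda>x. indicator K (plane_pt i j (y, x)) * f' (plane_pt i j (y, x))) has_integral
    (\<Sum>e \<in> {e \<in> es. fst e $ j \<noteq> snd e $ j \<and> height_param j e y \<in> {0..1}}.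
       sgn (edge_normal e $ i) * f (edge_at e (height_param j e y)))) UNIV"
proof -
  note fin = polygonal_cellD(3)[OF K] and K_compact = polygonal_cellD(1)[OF K] and ne = polygonal_cellD(4)[OF K]
    and fr = polygonal_cellD(5)[OF K] and disj = polygonal_cellD(6)[OF K]
  have K_closed: "closed K" using K_compact by (rule compact_imp_closed)
  define A where "A = {x. plane_pt i j (y, x) \<in> K}"
  define I where "I = {e \<in> es. fst e $ j \<noteq> snd e $ j \<and> height_param j e y \<in> {0..1}}"
  define c where "c e = edge_at e (height_param j e y) $ i" for e
  have pc: "plane_pt i j (y, c e) = edge_at e (height_param j e y)" if "e \<in> I" for e
    using that by (simp add: plane_pt_eq_iff[OF ij] c_def edge_at_def height_param_def I_def)
  have seg: "edge_at e (height_param j e y) \<in> open_segment (fst e) (snd e)" if "e \<in> I" for e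
  proof (rule edge_at_open_segment)
    have e: "e \<in> es" "fst e $ j \<noteq> snd e $ j" "height_param j e y \<in> {0..1}" using that by (auto simp: I_def)
    have "height_param j e y \<noteq> 0" "height_param j e y \<noteq> 1"
      using e(1,2) y by (auto simp: height_param_def)
    then show "0 < height_param j e y" "height_param j e y < 1" using e(3) by auto
    show "fst e \<noteq> snd e" using e(1) ne by auto
  qed
  have "((\<lambda>x. indicator A x * f' (plane_pt i j (y, x))) has_integral
      (\<Sum>e\<in>I. sgn (edge_normal e $ i) * f (plane_pt i j (y, c e)))) UNIV"
  proof (rule slice_integral[where g = "\<lambda>x. f (plane_pt i j (y, x))" and c = c])
    show "finite I" using fin by (simp add: I_def)
    show "inj_on c I"
    proof (rule inj_onI, rule ccontr)
      fix e e' assume e: "e \<in> I" "e' \<in> I" "c e = c e'" "e \<noteq> e'"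
      then have "edge_at e (height_param j e y) = edge_at e' (height_param j e' y)" by (metis pc)
      then show False using seg[OF e(1)] seg[OF e(2)] disj[of e e'] e
        by (auto simp: I_def open_segment_def)
    qed
    have "\<bar>x\<bar> \<le> M" if "\<And>z. z \<in> K \<Longrightarrow> norm z \<le> M" "x \<in> A" for x M
      using that component_le_norm_cart[of "plane_pt i j (y, x)" i] plane_pt_nth[OF ij, of y x]
      by (force simp: A_def)
    then show "bounded A" using compact_imp_bounded[OF K_compact] unfolding bounded_iff
      by (metis real_norm_def)
  next
    fix t
    have "plane_pt i j (y, t) + h *\<^sub>R axis i 1 = plane_pt i j (y, h + t)" for h
      by (simp add: plane_pt_def algebra_simps)
    then have "((\<lambda>h. f (plane_pt i j (y, h + t))) has_real_derivative f' (plane_pt i j (y, t))) (at 0)"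
      using f[of "plane_pt i j (y, t)"] by simp
    then show "((\<lambda>x. f (plane_pt i j (y, x))) has_real_derivative f' (plane_pt i j (y, t))) (at t)"
      using DERIV_shift[of "\<lambda>x. f (plane_pt i j (y, x))" _ 0 t] by simp
  next
    fix t assume t: "t \<notin> c ` I"
    let ?z = "plane_pt i j (y, t)"
    have "?z \<notin> frontier K"
    proof
      assume "?z \<in> frontier K"
      then obtain e u where e: "e \<in> es" "u \<in> {0..1}" "?z = edge_at e u"
        unfolding fr edge_at_closed_segment[symmetric] by (auto simp: edge_at_closed_segment)
      have yu: "y = fst e $ j + u * (snd e $ j - fst e $ j)"
        using plane_pt_nth(2)[OF ij, of y t] unfolding e(3) by (simp add: edge_at_def)
      \<comment> \<open>An edge parallel to the slice would have its endpoints at height y, which is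
        excluded.\<close>
      have "y \<noteq> fst e $ j" using y e(1) by auto
      then have "fst e $ j \<noteq> snd e $ j" using yu by auto
      moreover from this have "height_param j e y = u" unfolding height_param_def yu by simp
      ultimately have "e \<in> I" "c e = t" using e plane_pt_nth(1)[OF ij, of y t] by (auto simp: I_def c_def)
      then show False using t by auto
    qed
    have lim: "((\<lambda>u. plane_pt i j (y, u)) \<longlongrightarrow> ?z) (nhds t)"
      unfolding plane_pt_def prod.case by (intro tendsto_intros filterlim_ident)
    show "eventually (\<lambda>u. u \<in> A \<longleftrightarrow> t \<in> A) (nhds t)"
    proof (cases "?z \<in> K")
      case True
      then have "?z \<in> interior K" using \<open>?z \<notin> frontier K\<close> K_closed by (simp add: frontier_def)
      from topological_tendstoD[OF lim open_interior this] show ?thesis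
        by eventually_elim (use True interior_subset in \<open>auto simp: A_def\<close>)
    next
      case False
      then have "?z \<in> - K" by simp
      from topological_tendstoD[OF lim _ this] K_closed have "eventually (\<lambda>u. plane_pt i j (y, u) \<in> - K) (nhds t)"
        by (simp add: open_Compl)
      then show ?thesis by eventually_elim (use False in \<open>auto simp: A_def\<close>)
    qed
  next
    fix e assume e: "e \<in> I"
    let ?z = "plane_pt i j (y, c e)" and ?n = "edge_normal e $ i"
    have es: "e \<in> es" using e by (simp add: I_def)
    have n0: "?n \<noteq> 0" using edge_normal_nth[OF ne[OF es] ij] e by (auto simp: I_def split: if_splits)
    have "eventually (\<lambda>h. ?z + h *\<^sub>R axis i 1 \<in> K \<longleftrightarrow> h * (edge_normal e \<bullet> axis i 1) \<le> 0) (nhds 0)"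
      using seg[OF e] es n0 unfolding pc[OF e]
      by (intro polygonal_cell_crossing[OF K]) (auto simp: inner_axis)
    moreover have "filterlim (\<lambda>u. u - c e) (nhds 0) (nhds (c e))"
      by (auto intro!: tendsto_eq_intros filterlim_ident)
    ultimately have "eventually (\<lambda>u. ?z + (u - c e) *\<^sub>R axis i 1 \<in> K \<longleftrightarrow> (u - c e) * ?n \<le> 0) (nhds (c e))"
      by (auto simp: inner_axis dest: eventually_compose_filterlim)
    moreover have "?z + (u - c e) *\<^sub>R axis i 1 = plane_pt i j (y, u)" for u
      by (simp add: plane_pt_def algebra_simps)
    ultimately have ev: "eventually (\<lambda>u. u \<in> A \<longleftrightarrow> (u - c e) * ?n \<le> 0) (nhds (c e))" by (simp add: A_def)
    show "sgn ?n = 1 \<and> eventually (\<lambda>u. u \<in> A \<longleftrightarrow> u \<le> c e) (nhds (c e))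
      \<or> sgn ?n = - 1 \<and> eventually (\<lambda>u. u \<in> A \<longleftrightarrow> u \<ge> c e) (nhds (c e))"
    proof (cases "?n > 0")
      case True
      then have "(u - c e) * ?n \<le> 0 \<longleftrightarrow> u \<le> c e" for u by (simp add: mult_le_0_iff)
      then show ?thesis using True ev by simp
    next
      case False
      then have "?n < 0" using n0 by simp
      then have "(u - c e) * ?n \<le> 0 \<longleftrightarrow> u \<ge> c e" for u by (simp add: mult_le_0_iff)
      then show ?thesis using \<open>?n < 0\<close> ev by simp
    qed
  qed
  moreover have "(\<Sum>e\<in>I. sgn (edge_normal e $ i) * f (plane_pt i j (y, c e)))
      = (\<Sum>e\<in>I. sgn (edge_normal e $ i) * f (edge_at e (height_param j e y)))"
    using pc by (intro sum.cong) auto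
  ultimately show ?thesis unfolding I_def[symmetric] by (simp add: A_def indicator_def)
qed

text \<open>Fubini over slices in direction i; the exceptional heights are finitely many and hence
  negligible. Passing from the height y to the edge parameter produces the factor
  \<open>\<bar>snd e $ j - fst e $ j\<bar>\<close>, which together with the sign of the normal
  component is length times that component.\<close>

lemma polygonal_cell_divergence:
  fixes f f' :: "real^2 \<Rightarrow> real"
  assumes K: "polygonal_cell K es"
    and f: "\<And>x. ((\<lambda>t. f (x + t *\<^sub>R axis i 1)) has_real_derivative f' x) (at 0)"
    and f_cont: "continuous_on UNIV f" and f'_cont: "continuous_on UNIV f'"
  shows "integral K f' = (\<Sum>e\<in>es. edge_length e * edge_normal e $ i * integral {0..1} (\<lambda>t. f (edge_at e t)))"
proof -
  obtain j where ij: "i \<noteq> j" by (metis (full_types) exhaust_2 one_neq_zero zero_neq_one)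
  note fin = polygonal_cellD(3)[OF K] and K_compact = polygonal_cellD(1)[OF K] and ne = polygonal_cellD(4)[OF K]
  interpret lborel_pair: pair_sigma_finite "lborel :: real measure" "lborel :: real measure" ..
  let ?P = "plane_pt i j"
  define g where "g = (\<lambda>z. indicator K z * f' z)"
  have g_int: "integrable lborel g"
    using borel_integrable_compact[OF K_compact continuous_on_subset[OF f'_cont]] by (simp add: g_def)
  have [measurable]: "?P \<in> borel_measurable (lborel \<Otimes>\<^sub>M lborel)"
    using borel_measurable_continuous_onI[OF continuous_plane_pt] by (simp add: lborel_prod)
  have gP_int: "integrable (lborel \<Otimes>\<^sub>M lborel) (\<lambda>p. g (?P p))"
    using g_int borel_measurable_integrable[OF g_int]
    by (subst (asm) lborel_plane_pt[OF ij]) (simp add: integrable_distr_eq)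
  \<comment> \<open>The cut-off turns the condition that the slice meets the edge into part of the
    integrand, so that the integral over all heights can be taken edge by edge.\<close>
  define h where "h e y = indicator {0..1} y * f (edge_at e y)" for e and y :: real
  define G where "G y = (\<Sum>e\<in>es. if fst e $ j \<noteq> snd e $ j
      then sgn (edge_normal e $ i) * h e (height_param j e y) else 0)" for y
  have edge_cont: "continuous_on UNIV (\<lambda>t. f (edge_at e t))" for e
    unfolding edge_at_def by (intro continuous_on_compose2[OF f_cont] continuous_intros) auto
  have h_int: "integrable lborel (h e)" for e
    using borel_integrable_compact[of "{0..1}", OF _ continuous_on_subset[OF edge_cont[of e]]] by (simp add: h_def[abs_def])
  have h_val: "integral\<^sup>L lborel (h e) = integral {0..1} (\<lambda>t. f (edge_at e t))" for e
    using set_borel_integral_eq_integral(2)[of "{0..1}" "\<lambda>t. f (edge_at e t)"] h_int[of e]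
    by (simp add: set_integrable_def set_lebesgue_integral_def h_def[abs_def])
  have hp_int: "integrable lborel (\<lambda>y. h e (height_param j e y))" if "fst e $ j \<noteq> snd e $ j" for e
  proof -
    let ?d = "snd e $ j - fst e $ j"
    have "(\<lambda>y. h e (height_param j e y)) = (\<lambda>y. h e (- (fst e $ j) / ?d + 1 / ?d * y))"
      by (simp add: height_param_def diff_divide_distrib)
    then show ?thesis using lborel_integrable_real_affine[OF h_int, of "1 / ?d" e "- (fst e $ j) / ?d"] that
      by simp
  qed
  have hp_val: "(\<integral>y. h e (height_param j e y) \<partial>lborel) = \<bar>snd e $ j - fst e $ j\<bar> * integral {0..1} (\<lambda>t. f (edge_at e t))"
    if "fst e $ j \<noteq> snd e $ j" for e
    using that by (subst lborel_integral_real_affine[where t = "fst e $ j" and c = "snd e $ j - fst e $ j"])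
      (auto simp: height_param_def h_val)
  have term_int: "integrable lborel (\<lambda>y. if fst e $ j \<noteq> snd e $ j
      then sgn (edge_normal e $ i) * h e (height_param j e y) else 0)" for e
    using hp_int[of e] by (cases "fst e $ j = snd e $ j") auto
  have G_int: "integrable lborel G"
    unfolding G_def by (intro Bochner_Integration.integrable_sum term_int)
  have inner: "(\<integral>x. g (?P (y, x)) \<partial>lborel) = G y" if y: "y \<notin> (\<lambda>p. p $ j) ` (fst ` es \<union> snd ` es)" for y
  proof -
    have cont: "continuous_on UNIV (\<lambda>x. ?P (y, x))"
      by (intro continuous_on_compose2[OF continuous_plane_pt] continuous_intros) auto
    have "bounded ((\<lambda>x. ?P (y, x)) -` K)"
    proof -
      have "(\<lambda>x. ?P (y, x)) -` K \<subseteq> (\<lambda>z. z $ i) ` K"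
        by (rule subsetI) (metis image_eqI plane_pt_nth(1)[OF ij] vimageD)
      moreover have "bounded ((\<lambda>z. z $ i) ` K)"
        using K_compact by (intro compact_imp_bounded compact_continuous_image continuous_intros)
      ultimately show ?thesis using bounded_subset by blast
    qed
    moreover have "closed ((\<lambda>x. ?P (y, x)) -` K)"
      using continuous_closed_preimage[OF cont closed_UNIV compact_imp_closed[OF K_compact]] by (simp only: Int_UNIV_left)
    ultimately have "compact ((\<lambda>x. ?P (y, x)) -` K)" by (simp only: compact_eq_bounded_closed)
    moreover have "continuous_on ((\<lambda>x. ?P (y, x)) -` K) (\<lambda>x. f' (?P (y, x)))"
      by (rule continuous_on_compose2[OF f'_cont continuous_on_subset[OF cont]]) auto
    ultimately have "integrable lborel (\<lambda>x. indicator ((\<lambda>x. ?P (y, x)) -` K) x *\<^sub>R f' (?P (y, x)))"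
      by (rule borel_integrable_compact)
    then have "integrable lborel (\<lambda>x. g (?P (y, x)))" by (simp add: g_def indicator_def)
    from has_integral_integral_lborel[OF this]
    have "(\<integral>x. g (?P (y, x)) \<partial>lborel) = (\<Sum>e \<in> {e \<in> es. fst e $ j \<noteq> snd e $ j \<and> height_param j e y \<in> {0..1}}.
       sgn (edge_normal e $ i) * f (edge_at e (height_param j e y)))"
      using polygonal_cell_slice_integral[OF K ij f y] unfolding g_def by (rule has_integral_unique)
    also have "\<dots> = G y"
      unfolding G_def h_def using fin by (subst sum.inter_filter) (auto intro!: sum.cong simp: indicator_def)
    finally show ?thesis .
  qed
  have "integral K f' = integral\<^sup>L lborel g"
    using set_borel_integral_eq_integral(2)[of K f'] g_int
    by (simp add: set_integrable_def set_lebesgue_integral_def g_def)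
  also have "\<dots> = integral\<^sup>L (lborel \<Otimes>\<^sub>M lborel) (\<lambda>p. g (?P p))"
    using borel_measurable_integrable[OF g_int] by (subst lborel_plane_pt[OF ij]) (simp add: integral_distr)
  also have "\<dots> = (\<integral>y. (\<integral>x. g (?P (y, x)) \<partial>lborel) \<partial>lborel)"
    using lborel_pair.integral_fst'[OF gP_int] by simp
  also have "\<dots> = integral\<^sup>L lborel G"
  proof (rule integral_cong_AE)
    show "(\<lambda>y. \<integral>x. g (?P (y, x)) \<partial>lborel) \<in> borel_measurable lborel"
      using lborel_pair.integrable_fst'[OF gP_int] by (rule borel_measurable_integrable)
    show "G \<in> borel_measurable lborel" using G_int by (rule borel_measurable_integrable)
    have "finite ((\<lambda>p. p $ j) ` (fst ` es \<union> snd ` es))" using fin by simp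
    from AE_not_in[OF finite_imp_null_set_lborel[OF this]]
    show "AE y in lborel. (\<integral>x. g (?P (y, x)) \<partial>lborel) = G y"
      by eventually_elim (rule inner)
  qed
  also have "\<dots> = (\<Sum>e\<in>es. if fst e $ j \<noteq> snd e $ j
      then sgn (edge_normal e $ i) * (\<bar>snd e $ j - fst e $ j\<bar> * integral {0..1} (\<lambda>t. f (edge_at e t))) else 0)"
    unfolding G_def Bochner_Integration.integral_sum[OF term_int] by (intro sum.cong) (auto simp: hp_val)
  also have "\<dots> = (\<Sum>e\<in>es. edge_length e * edge_normal e $ i * integral {0..1} (\<lambda>t. f (edge_at e t)))"
  proof (rule sum.cong[OF refl])
    fix e assume e: "e \<in> es"
    have len: "edge_length e > 0" using ne[OF e] by (cases e) (auto simp: edge_length_def)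
    have eq: "edge_length e * edge_normal e $ i = (if i = 1 then 1 else - 1) * (snd e $ j - fst e $ j)"
      using edge_normal_nth[OF ne[OF e] ij] by simp
    then have "edge_length e * \<bar>edge_normal e $ i\<bar> = \<bar>snd e $ j - fst e $ j\<bar>"
      using len abs_mult[of "edge_length e" "edge_normal e $ i"] by (auto split: if_splits)
    then have *: "sgn (edge_normal e $ i) * \<bar>snd e $ j - fst e $ j\<bar> = edge_length e * edge_normal e $ i"
      using sgn_mult_abs[of "edge_normal e $ i"] by (metis mult.left_commute)
    have "edge_length e * edge_normal e $ i = 0" if "fst e $ j = snd e $ j" using eq that by simp
    then show "(if fst e $ j \<noteq> snd e $ j
      then sgn (edge_normal e $ i) * (\<bar>snd e $ j - fst e $ j\<bar> * integral {0..1} (\<lambda>t. f (edge_at e t))) else 0)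
      = edge_length e * edge_normal e $ i * integral {0..1} (\<lambda>t. f (edge_at e t))"
      by (simp only: mult.assoc[symmetric] *) simp
  qed
  finally show ?thesis .
qed

section \<open>Polynomials and Gauss rules\<close>

lemma poly_deg_leI:
  "f = (\<lambda>x. \<Sum>i\<le>k. \<Sum>j\<le>k - i. c i j * (x $ 1)^i * (x $ 2)^j) \<Longrightarrow> poly_deg_le k f"
  unfolding poly_deg_le_def by blast

lemma poly_deg_le_add:
  assumes "poly_deg_le k f" "poly_deg_le k g"
  shows "poly_deg_le k (\<lambda>x. f x + g x)"
proof -
  obtain c d where "f = (\<lambda>x. \<Sum>i\<le>k. \<Sum>j\<le>k - i. c i j * (x $ 1)^i * (x $ 2)^j)"
    "g = (\<lambda>x. \<Sum>i\<le>k. \<Sum>j\<le>k - i. d i j * (x $ 1)^i * (x $ 2)^j)"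
    using assms unfolding poly_deg_le_def by blast
  then show ?thesis
    by (intro poly_deg_leI[where c = "\<lambda>i j. c i j + d i j"]) (simp add: sum.distrib distrib_right)
qed

lemma poly_deg_le_mult:
  assumes "poly_deg_le k f"
  shows "poly_deg_le k (\<lambda>x. r * f x)"
proof -
  obtain c where "f = (\<lambda>x. \<Sum>i\<le>k. \<Sum>j\<le>k - i. c i j * (x $ 1)^i * (x $ 2)^j)"
    using assms unfolding poly_deg_le_def by blast
  then show ?thesis
    by (intro poly_deg_leI[where c = "\<lambda>i j. r * c i j"]) (simp add: sum_distrib_left mult.assoc)
qed

lemma poly_deg_le_const: "poly_deg_le k (\<lambda>x. r)"
proof (rule poly_deg_leI[where c = "\<lambda>i j. if i = 0 then (if j = 0 then r else 0) else 0"], rule ext)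
  fix x :: "real^2"
  have "(\<Sum>i\<le>k. \<Sum>j\<le>k - i. (if i = 0 then (if j = 0 then r else 0) else 0) * (x $ 1)^i * (x $ 2)^j)
    = (\<Sum>i\<le>k. if i = 0 then (\<Sum>j\<le>k. if j = 0 then r else 0) else 0)"
    by (intro sum.cong) (auto simp: mult_delta_left)
  then show "r = (\<Sum>i\<le>k. \<Sum>j\<le>k - i. (if i = 0 then (if j = 0 then r else 0) else 0) * (x $ 1)^i * (x $ 2)^j)"
    by (simp add: mult_delta_left)
qed

lemma poly_deg_le_sum:
  assumes "\<And>b. b \<in> S \<Longrightarrow> poly_deg_le k (f b)"
  shows "poly_deg_le k (\<lambda>x. \<Sum>b\<in>S. f b x)"
  using assms by (induction S rule: infinite_finite_induct) (auto intro: poly_deg_le_const poly_deg_le_add)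

lemma poly_deg_le_inner:
  fixes u :: "real^2 \<Rightarrow> 'a::euclidean_space"
  assumes "\<And>b. b \<in> Basis \<Longrightarrow> poly_deg_le k (\<lambda>x. u x \<bullet> b)"
  shows "poly_deg_le k (\<lambda>x. u x \<bullet> N)"
proof -
  have "(\<lambda>x. u x \<bullet> N) = (\<lambda>x. \<Sum>b\<in>Basis. (N \<bullet> b) * (u x \<bullet> b))"
    by (rule ext) (simp add: euclidean_inner[of _ N] mult.commute)
  then show ?thesis using assms by (auto intro!: poly_deg_le_sum poly_deg_le_mult)
qed

lemma poly_deg_le_partial:
  assumes "poly_deg_le k f"
  shows "((\<lambda>t. f (x + t *\<^sub>R axis i 1)) has_real_derivative pderivative i f x) (at 0)"
    and "continuous_on UNIV (pderivative i f)" and "continuous_on UNIV f"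
proof -
  obtain c where f: "f = (\<lambda>x. \<Sum>a\<le>k. \<Sum>b\<le>k - a. c a b * (x $ 1)^a * (x $ 2)^b)"
    using assms unfolding poly_deg_le_def by blast
  define f' where "f' x = (\<Sum>a\<le>k. \<Sum>b\<le>k - a. c a b *
    (of_nat a * (x $ 1)^(a - 1) * (axis i 1 $ 1) * (x $ 2)^b + (x $ 1)^a * (of_nat b * (x $ 2)^(b - 1) * (axis i 1 $ 2))))"
    for x :: "real^2"
  have d: "((\<lambda>t. f (x + t *\<^sub>R axis i 1)) has_real_derivative f' x) (at 0)" for x
    unfolding f f'_def
    by (auto intro!: derivative_eq_intros sum.cong simp: algebra_simps)
  then have "pderivative i f x = f' x" for x
    unfolding pderivative_def
    by (intro vector_derivative_at) (simp add: has_real_derivative_iff_has_vector_derivative)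
  then have p: "pderivative i f = f'" by blast
  show "((\<lambda>t. f (x + t *\<^sub>R axis i 1)) has_real_derivative pderivative i f x) (at 0)" unfolding p by (rule d)
  show "continuous_on UNIV (pderivative i f)" unfolding p f'_def by (intro continuous_intros)
  show "continuous_on UNIV f" unfolding f by (intro continuous_intros)
qed

lemma poly_deg_le_edge:
  assumes "poly_deg_le k f"
  shows "\<exists>p :: real poly. degree p \<le> k \<and> (\<forall>t. f (edge_at e t) = poly p t)"
proof -
  obtain c where f: "f = (\<lambda>x. \<Sum>a\<le>k. \<Sum>b\<le>k - a. c a b * (x $ 1)^a * (x $ 2)^b)"
    using assms unfolding poly_deg_le_def by blast
  define l where "l i = [: fst e $ i, (snd e - fst e) $ i :]" for i :: 2
  define p where "p = (\<Sum>a\<le>k. \<Sum>b\<le>k - a. smult (c a b) (l 1 ^ a * l 2 ^ b))"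
  have dl: "degree (l i ^ a) \<le> a" for i a
    using degree_power_le[of "l i" a] by (simp add: l_def split: if_splits)
  have "degree (smult (c a b) (l 1 ^ a * l 2 ^ b)) \<le> k" if "b \<le> k - a" "a \<le> k" for a b
  proof -
    have "degree (smult (c a b) (l 1 ^ a * l 2 ^ b)) \<le> degree (l 1 ^ a * l 2 ^ b)" by (rule degree_smult_le)
    also have "\<dots> \<le> degree (l 1 ^ a) + degree (l 2 ^ b)" by (rule degree_mult_le)
    also have "\<dots> \<le> a + b" by (intro add_mono dl)
    finally show ?thesis using that by simp
  qed
  then have "degree p \<le> k" unfolding p_def by (intro degree_sum_le) auto
  moreover have "f (edge_at e t) = poly p t" for t
    unfolding f p_def l_def by (simp add: poly_sum edge_at_def mult.assoc)
  ultimately show ?thesis by blast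
qed

lemma edge_pt_eq: "edge_pt R e q = edge_at e (gauss_node R q)"
  by (simp add: edge_pt_def edge_at_def)

lemma gauss_rule_edge:
  assumes "gauss_rule (k + 1) (gauss_node R) (gauss_wt R)" "poly_deg_le k f"
  shows "(\<Sum>q=1..k+1. gauss_wt R q * f (edge_pt R e q)) = integral {0..1} (\<lambda>t. f (edge_at e t))"
proof -
  obtain p :: "real poly" where p: "degree p \<le> k" "\<And>t. f (edge_at e t) = poly p t"
    using poly_deg_le_edge[OF assms(2)] by blast
  then have "degree p \<le> 2 * (k + 1) - 1" by simp
  then show ?thesis using assms(1) unfolding gauss_rule_def edge_pt_eq p(2) by simp
qed

lemma integral_reflect_unit:
  fixes f :: "real \<Rightarrow> real"
  assumes "continuous_on UNIV f"
  shows "integral {0..1} (\<lambda>t. f (1 - t)) = integral {0..1} f"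
proof -
  have "(f has_integral integral {0..1} f) (cbox 0 1)"
    using continuous_on_subset[OF assms] by (auto intro!: integrable_integral integrable_continuous_interval)
  from has_integral_affinity[OF this, of "- 1" 1]
  have "((\<lambda>t. f (1 - t)) has_integral integral {0..1} f) ((\<lambda>x. 1 - x) ` {0..1})" by simp
  moreover have "(\<lambda>x. 1 - x) ` {0..1::real} = {0..1}" by (auto simp: image_iff intro: bexI[where x = "1 - _"])
  ultimately show ?thesis by (simp add: integral_unique)
qed

text \<open>The nodal polynomial \<open>P\<close> of a Gauss rule is orthogonal to all polynomials of lower degree, and so is
  its monic reflection \<open>P'\<close>.  Hence \<open>g = P - P'\<close>, which has lower degree, is orthogonal to itself, and the rule, exact for
  \<open>g\<^sup>2\<close>, shows that \<open>g\<close> vanishes at the nodes.\<close>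

lemma gauss_rule_symmetric:
  assumes G: "gauss_rule Q s w" and q: "q \<in> {1..Q}"
  shows "\<exists>q'\<in>{1..Q}. s q' = 1 - s q"
proof -
  have exact: "(\<Sum>q=1..Q. w q * poly f (s q)) = integral {0..1} (poly f)" if "degree f \<le> 2 * Q - 1" for f
    using G that unfolding gauss_rule_def by blast
  have w: "w q > 0" if "q \<in> {1..Q}" for q using G that unfolding gauss_rule_def by blast
  define P where "P = (\<Prod>q=1..Q. [:- s q, 1:])"
  define P' where "P' = (\<Prod>q=1..Q. [:s q - 1, 1:])"
  define g where "g = P - P'"
  have dP: "degree P = Q" "degree P' = Q" and cP: "coeff P Q = 1" "coeff P' Q = 1"
  proof -
    have "degree (\<Prod>q=1..Q. [:f q, 1:]) = Q" "coeff (\<Prod>q=1..Q. [:f q, 1:]) Q = 1" for f :: "nat \<Rightarrow> real"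
    proof -
      show d: "degree (\<Prod>q=1..Q. [:f q, 1:]) = Q" by (subst degree_prod_eq_sum_degree) auto
      have "lead_coeff (\<Prod>q=1..Q. [:f q, 1:]) = 1" by (simp add: lead_coeff_prod)
      then show "coeff (\<Prod>q=1..Q. [:f q, 1:]) Q = 1" unfolding d .
    qed
    from this[of "\<lambda>q. - s q"] this[of "\<lambda>q. s q - 1"] show "degree P = Q" "degree P' = Q" "coeff P Q = 1" "coeff P' Q = 1"
      by (simp_all add: P_def P'_def)
  qed
  have dg: "degree g \<le> Q - 1"
  proof (rule degree_le, intro allI impI)
    fix i assume "Q - 1 < i"
    then consider "i = Q" | "i > Q" by linarith
    then show "coeff g i = 0" using dP cP by cases (auto simp: g_def coeff_eq_0)
  qed
  have P_node: "poly P (s q) = 0" if "q \<in> {1..Q}" for q using that by (auto simp: P_def poly_prod)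
  have orth: "integral {0..1} (poly (P * f)) = 0" if "degree f \<le> Q - 1" for f
  proof -
    have "degree (P * f) \<le> 2 * Q - 1" using degree_mult_le[of P f] dP that q by auto
    from exact[OF this] show ?thesis using P_node by (simp add: sum.neutral)
  qed
  define r :: "real poly" where "r = [:1, - 1:]"
  have P'_refl: "poly P' t = (- 1)^Q * poly P (1 - t)" for t
  proof -
    have "poly P' t = (\<Prod>q=1..Q. - 1 * (1 - t - s q))" unfolding P'_def by (simp add: poly_prod algebra_simps)
    then show ?thesis unfolding prod.distrib by (simp add: P_def poly_prod algebra_simps)
  qed
  have "integral {0..1} (poly (P' * g)) = integral {0..1} (\<lambda>t. (- 1)^Q * poly (P * pcompose g r) (1 - t))"
    by (intro arg_cong[where f = "integral _"] ext) (simp add: P'_refl poly_pcompose r_def)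
  also have "\<dots> = (- 1)^Q * integral {0..1} (poly (P * pcompose g r))"
    using integral_reflect_unit[of "poly (P * pcompose g r)"]
    by (simp add: continuous_on_poly del: poly_mult)
  also have "\<dots> = 0"
  proof -
    have "degree (pcompose g r) \<le> Q - 1" using degree_pcompose_le[of g r] dg by (simp add: r_def)
    then show ?thesis using orth by simp
  qed
  finally have "integral {0..1} (poly (P' * g)) = 0" .
  moreover have "integral {0..1} (poly (g * g)) = integral {0..1} (poly (P * g)) - integral {0..1} (poly (P' * g))"
    by (subst integral_diff[symmetric])
      (auto intro!: integrable_continuous_interval continuous_intros arg_cong[where f = "integral _"] simp: g_def algebra_simps)
  ultimately have "integral {0..1} (poly (g * g)) = 0" using orth[OF dg] by simp
  moreover have "degree (g * g) \<le> 2 * Q - 1" using degree_mult_le[of g g] dg by linarith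
  ultimately have "(\<Sum>q=1..Q. w q * (poly g (s q))^2) = 0" using exact[of "g * g"] by (simp add: power2_eq_square)
  then have "w q * (poly g (s q))^2 = 0"
    using q w by (subst (asm) sum_nonneg_eq_0_iff) (auto simp: less_imp_le)
  then have "poly P' (s q) = 0" using w[OF q] P_node[OF q] by (simp add: g_def)
  then obtain q' where "q' \<in> {1..Q}" "s q' - 1 + s q = 0" unfolding P'_def by (auto simp: poly_prod prod_zero_iff)
  then show ?thesis by (intro bexI[of _ q']) auto
qed

section \<open>Cell averages\<close>

lemma area_pos:
  assumes "polygonal_cell K es"
  shows "area K > 0"
proof -
  have m: "K \<in> lmeasurable" using polygonal_cellD(1)[OF assms] by (rule lmeasurable_compact)
  have "\<not> negligible (interior K)" using polygonal_cellD(2)[OF assms] by (intro open_not_negligible) auto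
  then have "\<not> negligible K" using negligible_subset interior_subset by blast
  then have "measure lebesgue K \<noteq> 0" using negligible_iff_measure0[OF m] by simp
  then show ?thesis using measure_nonneg[of lebesgue K] unfolding area_def by linarith
qed

lemma polygonal_cell_integrable:
  assumes "polygonal_cell K es" "continuous_on UNIV (f :: real^2 \<Rightarrow> real)"
  shows "f integrable_on K"
  using borel_integrable_compact[OF polygonal_cellD(1)[OF assms(1)], of f] assms(2)
  by (intro set_borel_integral_eq_integral(1)) (auto simp: set_integrable_def intro: continuous_on_subset)

lemma edge_normals_sum:
  assumes "polygonal_cell K es"
  shows "(\<Sum>e\<in>es. edge_length e * edge_normal e $ i) = 0"
  using polygonal_cell_divergence[OF assms, of "\<lambda>_. 1" i "\<lambda>_. 0"] by simp

lemma divergence_free_edge_sum: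
  assumes K: "polygonal_cell K es" and G: "gauss_rule (k + 1) (gauss_node R) (gauss_wt R)"
    and B1: "poly_deg_le k B1" and B2: "poly_deg_le k B2"
    and div: "\<And>x. x \<in> K \<Longrightarrow> pderivative 1 B1 x + pderivative 2 B2 x = 0"
  shows "(\<Sum>e\<in>es. edge_length e * (\<Sum>q=1..k+1. gauss_wt R q *
     (edge_normal e $ 1 * B1 (edge_pt R e q) + edge_normal e $ 2 * B2 (edge_pt R e q)))) = 0"
proof -
  have "(\<Sum>q=1..k+1. gauss_wt R q * (edge_normal e $ 1 * B1 (edge_pt R e q) + edge_normal e $ 2 * B2 (edge_pt R e q)))
    = edge_normal e $ 1 * integral {0..1} (\<lambda>t. B1 (edge_at e t)) + edge_normal e $ 2 * integral {0..1} (\<lambda>t. B2 (edge_at e t))" for e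
    unfolding gauss_rule_edge[OF G B1, symmetric] gauss_rule_edge[OF G B2, symmetric]
    by (simp add: sum_distrib_left sum.distrib distrib_left mult.left_commute del: sum.cl_ivl_Suc)
  then have "(\<Sum>e\<in>es. edge_length e * (\<Sum>q=1..k+1. gauss_wt R q *
     (edge_normal e $ 1 * B1 (edge_pt R e q) + edge_normal e $ 2 * B2 (edge_pt R e q))))
    = integral K (pderivative 1 B1) + integral K (pderivative 2 B2)"
    using polygonal_cell_divergence[OF K poly_deg_le_partial(1)[OF B1] poly_deg_le_partial(3)[OF B1] poly_deg_le_partial(2)[OF B1]]
      polygonal_cell_divergence[OF K poly_deg_le_partial(1)[OF B2] poly_deg_le_partial(3)[OF B2] poly_deg_le_partial(2)[OF B2]]
    by (simp add: distrib_left sum.distrib mult.assoc del: sum.cl_ivl_Suc)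
  also have "\<dots> = integral K (\<lambda>x. pderivative 1 B1 x + pderivative 2 B2 x)"
    by (intro integral_add[symmetric] polygonal_cell_integrable[OF K] poly_deg_le_partial(2)[OF B1] poly_deg_le_partial(2)[OF B2])
  also have "\<dots> = integral K (\<lambda>x. 0)" using div by (intro integral_cong) auto
  also have "\<dots> = 0" by simp
  finally show ?thesis .
qed

lemma cell_average_inner:
  fixes u :: "real^2 \<Rightarrow> state"
  assumes K: "polygonal_cell K es" and u: "\<And>b. b \<in> Basis \<Longrightarrow> poly_deg_le k (\<lambda>x. u x \<bullet> b)"
  shows "u integrable_on K" "cell_average K u \<bullet> N = cell_average K (\<lambda>x. u x \<bullet> N)"
proof -
  have "(\<lambda>x. u x \<bullet> b) integrable_on K" if "b \<in> Basis" for b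
    using polygonal_cell_integrable[OF K poly_deg_le_partial(3)[OF u[OF that]]] .
  then show *: "u integrable_on K" by (subst integrable_componentwise_iff) auto
  show "cell_average K u \<bullet> N = cell_average K (\<lambda>x. u x \<bullet> N)"
    using integral_linear[OF * bounded_linear_inner_left[of N]]
    by (simp add: cell_average_def o_def)
qed

lemma mag_component: "mag u $ i = u \<bullet> (0, 0, axis i 1, 0)"
  by (cases u) (simp add: mag_def inner_axis)

lemma mag_Basis: "(0, 0, axis i 1, 0) \<in> (Basis :: state set)"
  by (auto simp: Basis_prod_def axis_in_Basis_iff)

lemma W_spaceD:
  assumes "u \<in> W_space M k" "K \<in> cells M"
  shows "b \<in> Basis \<Longrightarrow> poly_deg_le k (\<lambda>x. u K x \<bullet> b)" "poly_deg_le k (\<lambda>x. mag (u K x) $ i)"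
    "x \<in> K \<Longrightarrow> pderivative 1 (\<lambda>y. mag (u K y) $ 1) x + pderivative 2 (\<lambda>y. mag (u K y) $ 2) x = 0"
  using assms mag_Basis[of i] unfolding W_space_def mag_component by blast+

lemma W_space_add_scaled:
  assumes u: "u \<in> W_space M k" and v: "v \<in> W_space M k"
  shows "(\<lambda>K x. u K x + r *\<^sub>R v K x) \<in> W_space M k"
proof -
  have "pderivative i (\<lambda>y. mag (u K y + r *\<^sub>R v K y) $ l) x
      = pderivative i (\<lambda>y. mag (u K y) $ l) x + r * pderivative i (\<lambda>y. mag (v K y) $ l) x"
    if "K \<in> cells M" for i l K x
  proof -
    have "((\<lambda>t. mag (u K (x + t *\<^sub>R axis i 1) + r *\<^sub>R v K (x + t *\<^sub>R axis i 1)) $ l) has_real_derivative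
      pderivative i (\<lambda>y. mag (u K y) $ l) x + r * pderivative i (\<lambda>y. mag (v K y) $ l) x) (at 0)"
      using poly_deg_le_partial(1)[where i = i and x = x, OF W_spaceD(2)[OF u that, of l]]
        poly_deg_le_partial(1)[where i = i and x = x, OF W_spaceD(2)[OF v that, of l]]
      unfolding mag_component by (auto simp: inner_add_left intro!: derivative_eq_intros)
    then show ?thesis unfolding pderivative_def[of i "\<lambda>y. mag (u K y + r *\<^sub>R v K y) $ l"]
      by (intro vector_derivative_at) (simp add: has_real_derivative_iff_has_vector_derivative)
  qed
  then show ?thesis using W_spaceD[OF u] W_spaceD[OF v] unfolding W_space_def
    by (auto simp: inner_add_left intro!: poly_deg_le_add poly_deg_le_mult)
      (smt (verit) distrib_left mult_zero_right)
qed

text \<open>Constants are divergence-free, hence valid test functions; testing with them yields the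
  cell averages of L.\<close>

lemma W_space_const: "(\<lambda>K x. N) \<in> W_space M k"
  unfolding W_space_def by (auto intro: poly_deg_le_const simp: pderivative_def)

text \<open>The neighbour runs through the common edge backwards, so the q-th Gauss point seen from
  K is one of its own Gauss points only because the nodes are symmetric; its index q' there may
  differ from q.\<close>

lemma ext_trace_admissible:
  assumes mesh: "polygonal_mesh M" and quad: "admissible_quadratures k M R"
    and U: "U \<in> G_space H M k (\<lambda>K. S_hat k M R K \<union> T K)"
    and K: "K \<in> cells M" and e: "e \<in> edges M K" and q: "q \<in> {1..k+1}"
  shows "ext_trace M U K e (edge_pt R e q) \<in> admissible H"
proof -
  let ?K = "neighbor M K e" and ?e = "opposite_edge M K e"
  have K': "?K \<in> cells M" "?e \<in> edges M ?K"
    using mesh K e unfolding polygonal_mesh_def Let_def by blast+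
  obtain q' where q': "q' \<in> {1..k+1}" "gauss_node R q' = 1 - gauss_node R q"
    using gauss_rule_symmetric[OF _ q] quad unfolding admissible_quadratures_def by blast
  have "edge_pt R e q + shift M K e = edge_pt R ?e q'"
    by (simp add: edge_pt_def opposite_edge_def q'(2) algebra_simps)
  then have "edge_pt R e q + shift M K e \<in> S_hat k M R ?K"
    using K'(2) q'(1) unfolding S_hat_def by blast
  then show ?thesis using U K'(1) unfolding G_space_def ext_trace_def by blast
qed

lemma int_trace_admissible:
  assumes "U \<in> G_space H M k (\<lambda>K. S_hat k M R K \<union> T K)" "K \<in> cells M" "e \<in> edges M K" "q \<in> {1..k+1}"
  shows "U K (edge_pt R e q) \<in> admissible H"
  using assms unfolding G_space_def S_hat_def by blast

section \<open>Bounds for the numerical flux at one edge point\<close>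

lemma ndotF_minus: "ndotF H (- n) U = - ndotF H n U"
  by (simp add: ndotF_def)

lemma ndotB_minus: "ndotB (- n) B = - ndotB n B"
  by (simp add: ndotB_def)

text \<open>The flux estimate is used with normal \<open>- n\<close> for both traces, and the source term exactly replaces the average of the two
  normal components of \<open>B\<close> by the interior one.\<close>

lemma edge_flux_bound:
  assumes eos: "eos H" and Ui: "Ui \<in> admissible H" and Ue: "Ue \<in> admissible H"
    and n: "norm n = 1" and w: "norm w < 1"
  shows "- ((num_flux H Ui Ue n + ((1/2) * ndotB n (mag Ue - mag Ui)) *\<^sub>R source H Ui) \<bullet> nstar w b)
    \<ge> - (a_visc + (1/2) * \<bar>ndotB n (mag Ui - mag Ue)\<bar> / sqrt (density H Ui * enthalpy H Ui)) * (Ui \<bullet> nstar w b + mag_pressure w b)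
      + (mag_pressure w b * (embed n \<bullet> w) - (w \<bullet> b) * ndotB n (mag Ui))"
proof -
  have F: "(V - ndotF H n V) \<bullet> nstar w b + mag_pressure w b - (embed n \<bullet> w) * mag_pressure w b + ndotB n (mag V) * (w \<bullet> b) \<ge> 0"
    if "V \<in> admissible H" for V
    using flux_dual_nonneg[OF that eos w, of "- n" b] n by (simp add: ndotF_minus ndotB_minus embed_minus)
  define c where "c = (1/2) * ndotB n (mag Ui - mag Ue)"
  have c: "c = (1/2) * (ndotB n (mag Ui) - ndotB n (mag Ue))"
    by (simp add: c_def ndotB_def algebra_simps)
  have c': "(1/2) * ndotB n (mag Ue - mag Ui) = - c" by (simp add: c_def ndotB_def algebra_simps)
  have S: "c * (source H Ui \<bullet> nstar w b + w \<bullet> b)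
    \<ge> - (\<bar>c\<bar> / sqrt (density H Ui * enthalpy H Ui)) * (Ui \<bullet> nstar w b + mag_pressure w b)"
    by (rule source_dual_bound[OF Ui eos w])
  have abs: "(1/2) * \<bar>ndotB n (mag Ui - mag Ue)\<bar> = \<bar>c\<bar>" by (simp add: c_def abs_mult)
  \<comment> \<open>Regrouped, minus the numerical flux is (Ui - F(Ui)) / 2 + (Ue - F(Ue)) / 2 - Ui.
    The first two terms are covered by F, and the last one is the \<open>a_visc\<close> part of the
    coefficient.\<close>
  have N: "num_flux H Ui Ue n \<bullet> nstar w b = (ndotF H n Ui \<bullet> nstar w b + ndotF H n Ue \<bullet> nstar w b
      - (Ue \<bullet> nstar w b - Ui \<bullet> nstar w b)) / 2"
    by (simp add: num_flux_def a_visc_def inner_add_left inner_diff_left)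
  have cw: "c * (w \<bullet> b) = (ndotB n (mag Ui) * (w \<bullet> b) - ndotB n (mag Ue) * (w \<bullet> b)) / 2"
    by (simp add: c algebra_simps)
  have "- ((fi + fe - (ue - ui)) / 2 + - c * sn) \<ge> - (1 + \<bar>c\<bar> / h) * P + (mag_pressure w b * nw - (w \<bullet> b) * bi)"
    if "P = ui + mag_pressure w b" "ui - fi + mag_pressure w b - nw * mag_pressure w b + bi * (w \<bullet> b) \<ge> 0"
      "ue - fe + mag_pressure w b - nw * mag_pressure w b + be * (w \<bullet> b) \<ge> 0" "c * (sn + w \<bullet> b) \<ge> - (\<bar>c\<bar> / h) * P"
      "c * (w \<bullet> b) = (bi * (w \<bullet> b) - be * (w \<bullet> b)) / 2"
    for fi fe ui ue sn h P nw bi be :: real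
  proof -
    have key: "- ((fi + fe - (ue - ui)) / 2 + - y) \<ge> - P + s + (r - z)"
      if "P = ui + p" "ui - fi + p - r + z \<ge> 0" "ue - fe + p - r + z' \<ge> 0" "y + x \<ge> s" "x = (z - z') / 2"
      for p r x y z z' s :: real using that by (simp add: field_simps)
    have "c * sn + c * (w \<bullet> b) \<ge> - (\<bar>c\<bar> / h) * P" using that(4) by (simp only: distrib_left)
    moreover have "- (1 + \<bar>c\<bar> / h) * P = - P + (- (\<bar>c\<bar> / h) * P)" "- c * sn = - (c * sn)"
      "(w \<bullet> b) * bi = bi * (w \<bullet> b)" "mag_pressure w b * nw = nw * mag_pressure w b"
      by (simp_all add: algebra_simps)
    ultimately show ?thesis using key[OF that(1,2,3) _ that(5)] by metis
  qed
  from this[OF refl F[OF Ui, unfolded inner_diff_left] F[OF Ue, unfolded inner_diff_left] S cw]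
  show ?thesis unfolding abs c' inner_add_left inner_scaleR_left N a_visc_def .
qed

text \<open>The density component is transported with normal speed below 1 and receives no source,
  so no residual has to cancel between edges.\<close>

lemma density_flux_bound:
  assumes eos: "eos H" and Ui: "Ui \<in> admissible H" and Ue: "Ue \<in> admissible H" and n: "norm n = 1"
  shows "fst Ui > 0" "- fst (num_flux H Ui Ue n + r *\<^sub>R source H Ui) \<ge> - fst Ui"
proof -
  have *: "fst V > 0 \<and> \<bar>fst (ndotF H n V)\<bar> \<le> fst V" if V: "V \<in> admissible H" for V
  proof -
    obtain \<rho> v B p where prim: "prim_of H V = (\<rho>, v, B, p)" and q: "\<rho> > 0" and v: "norm v < 1"
      and V: "V = conserved H (\<rho>, v, B, p)"
      using admissible_cases[OF V eos] by metis
    have f: "fst V = \<rho> / sqrt (1 - v \<bullet> v)" unfolding V conserved_eq[OF v] by simp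
    then have pos: "fst V > 0" using q inner_self_less_one[OF v] by simp
    have "fst (ndotF H n V) = (embed n \<bullet> v) * fst V"
      unfolding ndotF_eq[OF prim V v V[unfolded conserved_eq[OF v]]] f by simp
    moreover have "\<bar>embed n \<bullet> v\<bar> \<le> 1"
      using inner_less_one[OF v, of "embed n"] n by (simp add: norm_embed inner_commute abs_le_iff)
    ultimately show ?thesis using pos by (simp add: abs_mult mult_left_le_one_le)
  qed
  show "fst Ui > 0" using *[OF Ui] by simp
  have "fst (source H Ui) = 0" by (simp add: source_def Let_def)
  then show "- fst (num_flux H Ui Ue n + r *\<^sub>R source H Ui) \<ge> - fst Ui"
    using *[OF Ui] *[OF Ue] by (auto simp: num_flux_def a_visc_def abs_le_iff)
qed

section \<open>Positivity of affine functionals of the updated cell average\<close>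

definition edge_residual ::
  "(real \<Rightarrow> real \<Rightarrow> real) \<Rightarrow> mesh \<Rightarrow> quadratures \<Rightarrow> broken \<Rightarrow> cell \<Rightarrow> edge \<Rightarrow> nat \<Rightarrow> state" where
  "edge_residual H M R U K e q =
     (let x = edge_pt R e q; n = edge_normal e; Ui = U K x; Ue = ext_trace M U K e x
      in num_flux H Ui Ue n + ((1/2) * ndotB n (mag Ue - mag Ui)) *\<^sub>R source H Ui)"

text \<open>Testing the scheme with a constant N removes the volume term, since N has no
  derivatives; the average of U is expanded by the special rule, whose nodes include the points
  where the edge terms are evaluated.\<close>

lemma cell_average_update:
  assumes mesh: "polygonal_mesh M" and quad: "admissible_quadratures k M R"
    and U: "U \<in> W_space M k" and L: "is_L_h H M k R U L" and K: "K \<in> cells M"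
  shows "cell_average K (\<lambda>x. U K x + dt *\<^sub>R L K x) \<bullet> N =
    (\<Sum>e\<in>edges M K. \<Sum>q=1..k+1. edge_wt R K e q * (U K (edge_pt R e q) \<bullet> N))
    + (\<Sum>q=1..int_num R K. int_wt R K q * (U K (int_pt R K q) \<bullet> N))
    - dt / area K * (\<Sum>e\<in>edges M K. edge_length e * (\<Sum>q=1..k+1. gauss_wt R q * (edge_residual H M R U K e q \<bullet> N)))"
proof -
  have poly: "polygonal_cell K (edges M K)" using mesh K unfolding polygonal_mesh_def by blast
  have LW: "L \<in> W_space M k" using L unfolding is_L_h_def by blast
  have "cell_average K (\<lambda>x. U K x + dt *\<^sub>R L K x) = cell_average K (U K) + dt *\<^sub>R cell_average K (L K)"
    using cell_average_inner(1)[OF poly W_spaceD(1)[OF U K]] cell_average_inner(1)[OF poly W_spaceD(1)[OF LW K]]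
    by (simp add: cell_average_def integral_add integrable_cmul scaleR_add_right)
  then have "cell_average K (\<lambda>x. U K x + dt *\<^sub>R L K x) \<bullet> N
      = cell_average K (\<lambda>x. U K x \<bullet> N) + dt * cell_average K (\<lambda>x. L K x \<bullet> N)"
    using cell_average_inner(2)[OF poly W_spaceD(1)[OF U K]] cell_average_inner(2)[OF poly W_spaceD(1)[OF LW K]]
    by (simp add: inner_add_left)
  moreover have "cell_average K (\<lambda>x. U K x \<bullet> N) =
      (\<Sum>e\<in>edges M K. \<Sum>q=1..k+1. edge_wt R K e q * (U K (edge_pt R e q) \<bullet> N))
      + (\<Sum>q=1..int_num R K. int_wt R K q * (U K (int_pt R K q) \<bullet> N))"
    using quad K poly_deg_le_inner[OF W_spaceD(1)[OF U K]]
    unfolding admissible_quadratures_def special_rule_def by blast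
  moreover have "integral K (\<lambda>x. L K x \<bullet> N) = J_form H M k R K U (\<lambda>K x. N)"
    using bspec[OF bspec[OF conjunct2[OF L[unfolded is_L_h_def]] W_space_const] K] .
  moreover have "pderivative i (\<lambda>x. N) x = 0" for i :: 2 and x
    by (simp add: pderivative_def)
  ultimately show ?thesis
    by (simp add: J_form_def edge_residual_def Let_def cell_average_def del: sum.cl_ivl_Suc)
qed

lemma sigma_nonneg:
  assumes "eos H" "U K (edge_pt R e q) \<in> admissible H"
  shows "sigma H M R U K e q \<ge> 0"
proof -
  obtain \<rho> v B p where "prim_of H (U K (edge_pt R e q)) = (\<rho>, v, B, p)" "\<rho> > 0" "H p \<rho> > 1"
    using admissible_cases[OF assms(2,1)] by metis
  then have "density H (U K (edge_pt R e q)) * enthalpy H (U K (edge_pt R e q)) \<ge> 0"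
    by (simp add: density_def enthalpy_def)
  then show ?thesis by (simp add: sigma_def Let_def)
qed

text \<open>The common mechanism for both admissibility conditions: the density uses c = 0 and r =
  0, the energy uses \<open>c = mag_pressure w b\<close> and the residuals r that cancel over the
  cell. The constant c can be moved inside the special rule because its weights add up to 1.\<close>

lemma cell_average_update_pos:
  assumes mesh: "polygonal_mesh M" and quad: "admissible_quadratures k M R"
    and dt: "dt > 0" and U: "U \<in> G_space H M k (\<lambda>K. S_hat k M R K \<union> S_breve R K)"
    and L: "is_L_h H M k R U L" and K: "K \<in> cells M"
    and CFL: "\<And>e q. e \<in> edges M K \<Longrightarrow> q \<in> {1..k+1} \<Longrightarrow>
                dt * (edge_length e / area K) * (a_visc + sigma H M R U K e q) < edge_wt R K e q / gauss_wt R q"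
    and pos: "\<And>V. V \<in> admissible H \<Longrightarrow> V \<bullet> N + c > 0"
    and res: "\<And>e q. e \<in> edges M K \<Longrightarrow> q \<in> {1..k+1} \<Longrightarrow> - (edge_residual H M R U K e q \<bullet> N)
       \<ge> - (a_visc + sigma H M R U K e q) * (U K (edge_pt R e q) \<bullet> N + c) + r e q"
    and r: "(\<Sum>e\<in>edges M K. edge_length e * (\<Sum>q=1..k+1. gauss_wt R q * r e q)) = 0"
  shows "cell_average K (\<lambda>x. U K x + dt *\<^sub>R L K x) \<bullet> N + c > 0"
proof -
  have poly: "polygonal_cell K (edges M K)" using mesh K unfolding polygonal_mesh_def by blast
  note A = area_pos[OF poly] and fin = polygonal_cellD(3)[OF poly]
  \<comment> \<open>Strict positivity is drawn from the edge points, as the special rule may have no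
    further nodes; a compact cell with interior points has a nonempty frontier and therefore an
    edge.\<close>
  have ne: "edges M K \<noteq> {}"
  proof
    assume "edges M K = {}"
    then have "frontier K = {}" using polygonal_cellD(5)[OF poly] by simp
    then show False using polygonal_cellD(1,2)[OF poly] frontier_eq_empty[of K] by (auto simp: not_compact_UNIV)
  qed
  have UW: "U \<in> W_space M k" using U by (simp add: G_space_def Gbar_space_def)
  have sp: "special_rule k M R K" using quad K unfolding admissible_quadratures_def by blast
  have w: "gauss_wt R q > 0" if "q \<in> {1..k+1}" for q
    using quad that unfolding admissible_quadratures_def gauss_rule_def by blast
  have len: "edge_length e > 0" if "e \<in> edges M K" for e
    using polygonal_cellD(4)[OF poly that] by (cases e) (auto simp: edge_length_def)
  define u where "u e q = U K (edge_pt R e q) \<bullet> N + c" for e q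
  define s where "s e q = a_visc + sigma H M R U K e q" for e q
  have u_pos: "u e q > 0" if "e \<in> edges M K" "q \<in> {1..k+1}" for e q
    unfolding u_def using int_trace_admissible[OF U K that] by (rule pos)
  have int_pos: "U K (int_pt R K q) \<bullet> N + c > 0" if "q \<in> {1..int_num R K}" for q
    using U K that by (intro pos) (auto simp: G_space_def S_hat_def)
  define d where "d = dt / area K"
  have d: "d > 0" using dt A by (simp add: d_def)
  \<comment> \<open>The CFL condition with denominators cleared: what remains of the weight of an
    edge node after the loss in \<open>res\<close>.\<close>
  have coeff: "edge_wt R K e q - d * edge_length e * gauss_wt R q * s e q > 0"
    if "e \<in> edges M K" "q \<in> {1..k+1}" for e q
    using CFL[OF that] w[OF that(2)] by (simp add: d_def s_def pos_less_divide_eq mult_ac)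
  let ?S = "\<lambda>f. \<Sum>e\<in>edges M K. \<Sum>q=1..k+1. f e q"
  have "cell_average K (\<lambda>x. U K x + dt *\<^sub>R L K x) \<bullet> N + c =
      ?S (\<lambda>e q. edge_wt R K e q * u e q) + (\<Sum>q=1..int_num R K. int_wt R K q * (U K (int_pt R K q) \<bullet> N + c))
      + ?S (\<lambda>e q. d * edge_length e * gauss_wt R q * - (edge_residual H M R U K e q \<bullet> N))"
  proof -
    have "?S (\<lambda>e q. edge_wt R K e q * u e q) + (\<Sum>q=1..int_num R K. int_wt R K q * (U K (int_pt R K q) \<bullet> N + c))
      = ?S (\<lambda>e q. edge_wt R K e q * (U K (edge_pt R e q) \<bullet> N)) + (\<Sum>q=1..int_num R K. int_wt R K q * (U K (int_pt R K q) \<bullet> N))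
        + (?S (edge_wt R K) + (\<Sum>q=1..int_num R K. int_wt R K q)) * c"
      unfolding u_def by (simp only: distrib_left distrib_right sum.distrib sum_distrib_right)
    also have "?S (edge_wt R K) + (\<Sum>q=1..int_num R K. int_wt R K q) = 1"
      using sp unfolding special_rule_def by blast
    finally have 1: "?S (\<lambda>e q. edge_wt R K e q * u e q) + (\<Sum>q=1..int_num R K. int_wt R K q * (U K (int_pt R K q) \<bullet> N + c))
      = ?S (\<lambda>e q. edge_wt R K e q * (U K (edge_pt R e q) \<bullet> N)) + (\<Sum>q=1..int_num R K. int_wt R K q * (U K (int_pt R K q) \<bullet> N)) + c"
      by simp
    have "?S (\<lambda>e q. d * edge_length e * gauss_wt R q * - (edge_residual H M R U K e q \<bullet> N))
      = - (d * (\<Sum>e\<in>edges M K. edge_length e * (\<Sum>q=1..k+1. gauss_wt R q * (edge_residual H M R U K e q \<bullet> N))))"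
      by (simp add: sum_distrib_left sum_negf mult.assoc del: sum.cl_ivl_Suc)
    then show ?thesis unfolding 1 cell_average_update[OF mesh quad UW L K] d_def[symmetric] by simp
  qed
  also have "\<dots> \<ge> ?S (\<lambda>e q. edge_wt R K e q * u e q) + 0
      + ?S (\<lambda>e q. d * edge_length e * gauss_wt R q * (- s e q * u e q + r e q))"
  proof (intro add_mono sum_mono order_refl)
    show "0 \<le> (\<Sum>q=1..int_num R K. int_wt R K q * (U K (int_pt R K q) \<bullet> N + c))"
      using sp int_pos unfolding special_rule_def by (intro sum_nonneg mult_nonneg_nonneg) (auto simp: less_imp_le)
    fix e q assume eq: "e \<in> edges M K" "q \<in> {1..k+1}"
    then show "d * edge_length e * gauss_wt R q * (- s e q * u e q + r e q)
       \<le> d * edge_length e * gauss_wt R q * - (edge_residual H M R U K e q \<bullet> N)"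
      using res[OF eq] d len w by (intro mult_left_mono) (auto simp: s_def u_def less_imp_le)
  qed
  moreover have "?S (\<lambda>e q. edge_wt R K e q * u e q) + 0
      + ?S (\<lambda>e q. d * edge_length e * gauss_wt R q * (- s e q * u e q + r e q))
    = ?S (\<lambda>e q. (edge_wt R K e q - d * edge_length e * gauss_wt R q * s e q) * u e q)
      + d * (\<Sum>e\<in>edges M K. edge_length e * (\<Sum>q=1..k+1. gauss_wt R q * r e q))"
    by (simp add: sum_distrib_left sum.distrib[symmetric] algebra_simps del: sum.cl_ivl_Suc)
  moreover have "?S (\<lambda>e q. (edge_wt R K e q - d * edge_length e * gauss_wt R q * s e q) * u e q) > 0"
    using fin ne coeff u_pos by (intro sum_pos mult_pos_pos) auto
  ultimately show ?thesis using r by simp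
qed

theorem theorem4p4:
  fixes H :: "real \<Rightarrow> real \<Rightarrow> real" and M :: mesh and R :: quadratures
    and k :: nat and dt :: real and U L :: broken
  assumes eos: "eos H"
    and cold_limit: "\<And>\<rho>. \<rho> > 0 \<Longrightarrow> ((\<lambda>p. internal_energy H p \<rho>) \<longlongrightarrow> 0) (at_right 0)"
    and mesh: "polygonal_mesh M"
    and quad: "admissible_quadratures k M R"
    and dt: "dt > 0"
    and U: "U \<in> G_space H M k (\<lambda>K. S_hat k M R K \<union> S_breve R K)"
    and L: "is_L_h H M k R U L"
    and CFL: "\<forall>K \<in> cells M. \<forall>e \<in> edges M K. \<forall>q \<in> {1..k+1}.
                dt * (edge_length e / area K) * (a_visc + sigma H M R U K e q)
                  < edge_wt R K e q / gauss_wt R q"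
  shows "(\<lambda>K x. U K x + dt *\<^sub>R L K x) \<in> Gbar_space H M k"
proof -
  have UW: "U \<in> W_space M k" using U by (simp add: G_space_def Gbar_space_def)
  have LW: "L \<in> W_space M k" using L unfolding is_L_h_def by blast
  have gauss: "gauss_rule (k + 1) (gauss_node R) (gauss_wt R)" using quad by (simp add: admissible_quadratures_def)
  have "cell_average K (\<lambda>x. U K x + dt *\<^sub>R L K x) \<in> admissible H" if K: "K \<in> cells M" for K
  proof -
    have poly: "polygonal_cell K (edges M K)" using mesh K unfolding polygonal_mesh_def by blast
    define V where "V = cell_average K (\<lambda>x. U K x + dt *\<^sub>R L K x)"
    obtain D m B E where V: "V = (D, m, B, E)" by (metis prod_cases4)
    note update_pos = cell_average_update_pos[OF mesh quad dt U L K, folded V_def]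
    have traces: "U K (edge_pt R e q) \<in> admissible H" "ext_trace M U K e (edge_pt R e q) \<in> admissible H"
      "norm (edge_normal e) = 1" if "e \<in> edges M K" "q \<in> {1..k+1}" for e q
      using int_trace_admissible[OF U K that] ext_trace_admissible[OF mesh quad U K that]
        edge_normal_norm polygonal_cellD(4)[OF poly] that by auto
    have "V \<bullet> (1, 0, 0, 0) + 0 > 0"
    proof (rule update_pos[where r = "\<lambda>e q. 0"])
      show "W \<bullet> (1, 0, 0, 0) + 0 > 0" if "W \<in> admissible H" for W
        using density_flux_bound(1)[OF eos that that, of "axis 1 1"] by (cases W) simp
      fix e q assume eq: "e \<in> edges M K" "q \<in> {1..k+1}"
      let ?Ui = "U K (edge_pt R e q)"
      have "- fst (edge_residual H M R U K e q) \<ge> - fst ?Ui" "fst ?Ui > 0"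
        using density_flux_bound[OF eos traces[OF eq]] unfolding edge_residual_def Let_def by blast+
      moreover have "sigma H M R U K e q * fst ?Ui \<ge> 0"
        using sigma_nonneg[where M = M and U = U and K = K, OF eos traces(1)[OF eq]] \<open>fst ?Ui > 0\<close> by simp
      moreover have "W \<bullet> (1, 0, 0, 0) = fst W" for W :: state by (cases W) simp
      ultimately show "- (edge_residual H M R U K e q \<bullet> (1, 0, 0, 0))
         \<ge> - (a_visc + sigma H M R U K e q) * (?Ui \<bullet> (1, 0, 0, 0) + 0) + 0"
        by (simp add: a_visc_def algebra_simps)
    qed (use CFL K in auto)
    then have "D > 0" by (simp add: V)
    \<comment> \<open>The vector b is frozen at the field B of the updated average itself. This is
      the instance that \<open>admissibleI\<close> asks for, and being constant on the cell it lets
      the residuals factor into the sum of the normals and the flux of the field.\<close>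
    moreover have "V \<bullet> nstar w B + mag_pressure w B > 0" if w: "norm w < 1" for w
    proof (rule update_pos[where r = "\<lambda>e q. mag_pressure w B * (embed (edge_normal e) \<bullet> w)
          - (w \<bullet> B) * ndotB (edge_normal e) (mag (U K (edge_pt R e q)))"])
      show "W \<bullet> nstar w B + mag_pressure w B > 0" if "W \<in> admissible H" for W
        by (rule admissible_energy_pos[OF that eos w])
      show "- (edge_residual H M R U K e q \<bullet> nstar w B)
         \<ge> - (a_visc + sigma H M R U K e q) * (U K (edge_pt R e q) \<bullet> nstar w B + mag_pressure w B)
          + (mag_pressure w B * (embed (edge_normal e) \<bullet> w) - (w \<bullet> B) * ndotB (edge_normal e) (mag (U K (edge_pt R e q))))"
        if "e \<in> edges M K" "q \<in> {1..k+1}" for e q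
        using edge_flux_bound[OF eos traces[OF that] w] unfolding edge_residual_def sigma_def Let_def .
      have w1: "(\<Sum>q=1..k+1. gauss_wt R q) = 1" using gauss unfolding gauss_rule_def by blast
      have "(\<Sum>e\<in>edges M K. edge_length e * (\<Sum>q=1..k+1. gauss_wt R q * (mag_pressure w B * (embed (edge_normal e) \<bullet> w)
          - (w \<bullet> B) * ndotB (edge_normal e) (mag (U K (edge_pt R e q))))))
        = (\<Sum>e\<in>edges M K. edge_length e * (mag_pressure w B * (embed (edge_normal e) \<bullet> w)))
          - (w \<bullet> B) * (\<Sum>e\<in>edges M K. edge_length e * (\<Sum>q=1..k+1. gauss_wt R q
              * ndotB (edge_normal e) (mag (U K (edge_pt R e q)))))"
      proof -
        have inner: "(\<Sum>q=1..k+1. gauss_wt R q * (x - y * z q)) = x - y * (\<Sum>q=1..k+1. gauss_wt R q * z q)" for x y and z :: "nat \<Rightarrow> real"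
        proof -
          have "(\<Sum>q=1..k+1. gauss_wt R q * (x - y * z q)) = (\<Sum>q=1..k+1. gauss_wt R q) * x - y * (\<Sum>q=1..k+1. gauss_wt R q * z q)"
            by (simp only: right_diff_distrib sum_subtractf sum_distrib_right sum_distrib_left mult.left_commute)
          then show ?thesis unfolding w1 by simp
        qed
        show ?thesis unfolding inner unfolding right_diff_distrib sum_subtractf
          by (simp add: sum_distrib_left mult.left_commute del: sum.cl_ivl_Suc)
      qed
      also have "(\<Sum>e\<in>edges M K. edge_length e * (mag_pressure w B * (embed (edge_normal e) \<bullet> w)))
          = mag_pressure w B * (w $ 1 * (\<Sum>e\<in>edges M K. edge_length e * edge_normal e $ 1)
            + w $ 2 * (\<Sum>e\<in>edges M K. edge_length e * edge_normal e $ 2))"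
        by (simp add: embed_def inner_vec_def sum_3 sum_distrib_left sum.distrib[symmetric] algebra_simps)
      also have "\<dots> = 0" unfolding edge_normals_sum[OF poly] by simp
      also have "(\<Sum>e\<in>edges M K. edge_length e * (\<Sum>q=1..k+1. gauss_wt R q
              * ndotB (edge_normal e) (mag (U K (edge_pt R e q))))) = 0"
        unfolding ndotB_def
        by (rule divergence_free_edge_sum[OF poly gauss W_spaceD(2)[OF UW K] W_spaceD(2)[OF UW K] W_spaceD(3)[OF UW K]])
      finally show "(\<Sum>e\<in>edges M K. edge_length e * (\<Sum>q=1..k+1. gauss_wt R q * (mag_pressure w B * (embed (edge_normal e) \<bullet> w)
          - (w \<bullet> B) * ndotB (edge_normal e) (mag (U K (edge_pt R e q)))))) = 0" by simp
    qed (use CFL K in auto)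
    ultimately show ?thesis unfolding V_def[symmetric] V by (intro admissibleI[OF eos cold_limit])
  qed
  then show ?thesis using W_space_add_scaled[OF UW LW] unfolding Gbar_space_def by blast
qed

end
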